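(* Suppose $|S|=3$ and there exist $s,t\in S$ with $m(s,t)=\infty$. Then $G$ is not of type $\mathrm{FP}_2$; in particular $G$ is not finitely presented.
   Context: Standing setup: $(W,S)$ is a Coxeter system with finite $S$ and $m(s,t)$ the order of $st$; for $J\subseteq S$, $W_J=\langle J\rangle$. $(\Delta_+,\Delta_-,\delta^* )$ is a thick twin building of type $(W,S)$ with Weyl distances $\delta_\pm$ and codistance $\delta^*$. There are integers $q_i\ge2$ such that every $s_i$-panel contains exactly $q_i+1$ chambers. A group $G$ acts strongly transitively on the twin building, i.e. by automorphisms preserving $\delta_+,\delta_-,\delta^*$ and transitively on pairs $(\Sigma,C)$ with $\Sigma$ a twin apartment and $C$ a chamber of $\Sigma$. For fixed opposite chambers $C_\pm$, $B_\pm=G_{C_\pm}$, and $T=B_+\cap B_-$ is assumed finite. (Example: $G=\mathcal{G}(\mathbb{F}_q)$ a Kac–Moody group over a finite field with rank $3$ Weyl group.) A group is of type $\mathrm{FP}_n$ if there is an exact sequence $P_n\to\cdots\to P_0\to\mathbb{Z}\to0$ of finitely generated projective $\mathbb{Z}[G]$-modules. *)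

theory Defs
  imports "HOL-Algebra.Multiplicative_Group" "HOL-Algebra.Group_Action"
          "HOL-Library.Function_Algebras"
begin

inductive word_cong :: "'a list set \<Rightarrow> 'a list \<Rightarrow> 'a list \<Rightarrow> bool" for R where
  wc_refl: "word_cong R u u"
| wc_sym: "word_cong R u v \<Longrightarrow> word_cong R v u"
| wc_trans: "word_cong R u v \<Longrightarrow> word_cong R v w \<Longrightarrow> word_cong R u w"
| wc_step: "r \<in> R \<Longrightarrow> word_cong R (u @ r @ v) (u @ v)"

definition word_prod :: "('g, 'b) monoid_scheme \<Rightarrow> 'g list \<Rightarrow> 'g" where
  "word_prod W ws = foldr (\<lambda>x y. x \<otimes>\<^bsub>W\<^esub> y) ws \<one>\<^bsub>W\<^esub>"

(* m(s,t) = order of st; in HOL-Algebra ord = 0 encodes infinite order *)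
definition cox_m :: "('w, 'b) monoid_scheme \<Rightarrow> 'w \<Rightarrow> 'w \<Rightarrow> nat" where
  "cox_m W s t = group.ord W (s \<otimes>\<^bsub>W\<^esub> t)"

definition coxeter_relators :: "('w, 'b) monoid_scheme \<Rightarrow> 'w set \<Rightarrow> 'w list set" where
  "coxeter_relators W S =
     {[s, s] | s. s \<in> S} \<union>
     {concat (replicate (cox_m W s t) [s, t]) | s t. s \<in> S \<and> t \<in> S \<and> cox_m W s t \<noteq> 0}"

definition coxeter_system :: "('w, 'b) monoid_scheme \<Rightarrow> 'w set \<Rightarrow> bool" where
  "coxeter_system W S \<longleftrightarrow> group W \<and> finite S \<and> S \<subseteq> carrier W \<and> \<one>\<^bsub>W\<^esub> \<notin> S \<and>
     (\<forall>s\<in>S. s \<otimes>\<^bsub>W\<^esub> s = \<one>\<^bsub>W\<^esub>) \<and>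
     carrier W = {word_prod W ws | ws. set ws \<subseteq> S} \<and>
     (\<forall>ws. set ws \<subseteq> S \<and> word_prod W ws = \<one>\<^bsub>W\<^esub> \<longrightarrow> word_cong (coxeter_relators W S) ws [])"

definition word_length :: "('w, 'b) monoid_scheme \<Rightarrow> 'w set \<Rightarrow> 'w \<Rightarrow> nat" where
  "word_length W S w = (LEAST n. \<exists>ws. length ws = n \<and> set ws \<subseteq> S \<and> word_prod W ws = w)"

section \<open>Buildings and twin buildings (W-metric approach, Abramenko--Brown)\<close>

definition building :: "('w, 'b) monoid_scheme \<Rightarrow> 'w set \<Rightarrow> 'c set \<Rightarrow> ('c \<Rightarrow> 'c \<Rightarrow> 'w) \<Rightarrow> bool" where
  "building W S C d \<longleftrightarrow> C \<noteq> {} \<and>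
     (\<forall>x\<in>C. \<forall>y\<in>C. d x y \<in> carrier W) \<and>
     (\<forall>x\<in>C. \<forall>y\<in>C. d x y = \<one>\<^bsub>W\<^esub> \<longleftrightarrow> x = y) \<and>
     (\<forall>x\<in>C. \<forall>y\<in>C. \<forall>x'\<in>C. \<forall>s\<in>S. d x' x = s \<longrightarrow>
         d x' y \<in> {s \<otimes>\<^bsub>W\<^esub> d x y, d x y} \<and>
         (word_length W S (s \<otimes>\<^bsub>W\<^esub> d x y) = word_length W S (d x y) + 1
            \<longrightarrow> d x' y = s \<otimes>\<^bsub>W\<^esub> d x y)) \<and>
     (\<forall>x\<in>C. \<forall>y\<in>C. \<forall>s\<in>S. \<exists>x'\<in>C. d x' x = s \<and> d x' y = s \<otimes>\<^bsub>W\<^esub> d x y)"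

definition twin_axioms_half :: "('w, 'b) monoid_scheme \<Rightarrow> 'w set \<Rightarrow> 'c set \<Rightarrow> 'c set
    \<Rightarrow> ('c \<Rightarrow> 'c \<Rightarrow> 'w) \<Rightarrow> ('c \<Rightarrow> 'c \<Rightarrow> 'w) \<Rightarrow> bool" where
  "twin_axioms_half W S Ca Cb da ds \<longleftrightarrow>
     (\<forall>x\<in>Ca. \<forall>y\<in>Cb. ds x y \<in> carrier W \<and> ds y x = inv\<^bsub>W\<^esub> (ds x y)) \<and>
     (\<forall>x\<in>Ca. \<forall>y\<in>Cb. \<forall>x'\<in>Ca. \<forall>s\<in>S. da x' x = s \<and>
         word_length W S (s \<otimes>\<^bsub>W\<^esub> ds x y) + 1 = word_length W S (ds x y)
         \<longrightarrow> ds x' y = s \<otimes>\<^bsub>W\<^esub> ds x y) \<and>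
     (\<forall>x\<in>Ca. \<forall>y\<in>Cb. \<forall>s\<in>S. \<exists>x'\<in>Ca. da x' x = s \<and> ds x' y = s \<otimes>\<^bsub>W\<^esub> ds x y)"

definition twin_building :: "('w, 'b) monoid_scheme \<Rightarrow> 'w set \<Rightarrow> 'c set \<Rightarrow> 'c set
    \<Rightarrow> ('c \<Rightarrow> 'c \<Rightarrow> 'w) \<Rightarrow> ('c \<Rightarrow> 'c \<Rightarrow> 'w) \<Rightarrow> ('c \<Rightarrow> 'c \<Rightarrow> 'w) \<Rightarrow> bool" where
  "twin_building W S Cp Cm dp dm ds \<longleftrightarrow> Cp \<inter> Cm = {} \<and>
     building W S Cp dp \<and> building W S Cm dm \<and>
     twin_axioms_half W S Cp Cm dp ds \<and> twin_axioms_half W S Cm Cp dm ds"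

definition panel :: "('w, 'b) monoid_scheme \<Rightarrow> 'c set \<Rightarrow> ('c \<Rightarrow> 'c \<Rightarrow> 'w) \<Rightarrow> 'w \<Rightarrow> 'c \<Rightarrow> 'c set" where
  "panel W C d s x = {y\<in>C. d x y = \<one>\<^bsub>W\<^esub> \<or> d x y = s}"

(* twin apartment: image of an isometry of the standard twin apartment W x {+,-} *)
definition twin_apartment :: "('w, 'b) monoid_scheme \<Rightarrow> 'c set \<Rightarrow> 'c set
    \<Rightarrow> ('c \<Rightarrow> 'c \<Rightarrow> 'w) \<Rightarrow> ('c \<Rightarrow> 'c \<Rightarrow> 'w) \<Rightarrow> ('c \<Rightarrow> 'c \<Rightarrow> 'w) \<Rightarrow> 'c set \<Rightarrow> bool" where
  "twin_apartment W Cp Cm dp dm ds \<Sigma> \<longleftrightarrow>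
     (\<exists>f :: 'w \<times> bool \<Rightarrow> 'c.
        \<Sigma> = f ` (carrier W \<times> UNIV) \<and>
        (\<forall>u\<in>carrier W. f (u, True) \<in> Cp \<and> f (u, False) \<in> Cm) \<and>
        (\<forall>u\<in>carrier W. \<forall>v\<in>carrier W.
           dp (f (u, True)) (f (v, True)) = inv\<^bsub>W\<^esub> u \<otimes>\<^bsub>W\<^esub> v \<and>
           dm (f (u, False)) (f (v, False)) = inv\<^bsub>W\<^esub> u \<otimes>\<^bsub>W\<^esub> v \<and>
           ds (f (u, True)) (f (v, False)) = inv\<^bsub>W\<^esub> u \<otimes>\<^bsub>W\<^esub> v))"

definition strongly_transitive ::
  "('g, 'e) monoid_scheme \<Rightarrow> ('g \<Rightarrow> 'c \<Rightarrow> 'c) \<Rightarrow> ('w, 'b) monoid_scheme \<Rightarrow> 'c set \<Rightarrow> 'c set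
    \<Rightarrow> ('c \<Rightarrow> 'c \<Rightarrow> 'w) \<Rightarrow> ('c \<Rightarrow> 'c \<Rightarrow> 'w) \<Rightarrow> ('c \<Rightarrow> 'c \<Rightarrow> 'w) \<Rightarrow> bool" where
  "strongly_transitive G \<phi> W Cp Cm dp dm ds \<longleftrightarrow>
     group_action G (Cp \<union> Cm) \<phi> \<and>
     (\<forall>g\<in>carrier G. \<phi> g ` Cp = Cp \<and> \<phi> g ` Cm = Cm \<and>
        (\<forall>x\<in>Cp. \<forall>y\<in>Cp. dp (\<phi> g x) (\<phi> g y) = dp x y) \<and>
        (\<forall>x\<in>Cm. \<forall>y\<in>Cm. dm (\<phi> g x) (\<phi> g y) = dm x y) \<and>
        (\<forall>x\<in>Cp \<union> Cm. \<forall>y\<in>Cp \<union> Cm. ds (\<phi> g x) (\<phi> g y) = ds x y)) \<and>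
     (\<forall>\<Sigma>1 \<Sigma>2 x1 x2. twin_apartment W Cp Cm dp dm ds \<Sigma>1 \<and> twin_apartment W Cp Cm dp dm ds \<Sigma>2 \<and>
        x1 \<in> \<Sigma>1 \<inter> Cp \<and> x2 \<in> \<Sigma>2 \<inter> Cp \<longrightarrow>
        (\<exists>g\<in>carrier G. \<phi> g ` \<Sigma>1 = \<Sigma>2 \<and> \<phi> g x1 = x2))"

definition ZG_module :: "('g, 'e) monoid_scheme \<Rightarrow> 'm::ab_group_add set \<Rightarrow> ('g \<Rightarrow> 'm \<Rightarrow> 'm) \<Rightarrow> bool" where
  "ZG_module G M a \<longleftrightarrow> 0 \<in> M \<and> (\<forall>x\<in>M. \<forall>y\<in>M. x + y \<in> M) \<and> (\<forall>x\<in>M. - x \<in> M) \<and>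
     (\<forall>g\<in>carrier G. \<forall>x\<in>M. a g x \<in> M) \<and>
     (\<forall>g\<in>carrier G. \<forall>x\<in>M. \<forall>y\<in>M. a g (x + y) = a g x + a g y) \<and>
     (\<forall>x\<in>M. a \<one>\<^bsub>G\<^esub> x = x) \<and>
     (\<forall>g\<in>carrier G. \<forall>h\<in>carrier G. \<forall>x\<in>M. a (g \<otimes>\<^bsub>G\<^esub> h) x = a g (a h x))"

definition ZG_linear :: "('g, 'e) monoid_scheme \<Rightarrow> 'm::ab_group_add set \<Rightarrow> ('g \<Rightarrow> 'm \<Rightarrow> 'm)
    \<Rightarrow> 'n::ab_group_add set \<Rightarrow> ('g \<Rightarrow> 'n \<Rightarrow> 'n) \<Rightarrow> ('m \<Rightarrow> 'n) \<Rightarrow> bool" where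
  "ZG_linear G M a N b f \<longleftrightarrow> (\<forall>x\<in>M. f x \<in> N) \<and>
     (\<forall>x\<in>M. \<forall>y\<in>M. f (x + y) = f x + f y) \<and>
     (\<forall>g\<in>carrier G. \<forall>x\<in>M. f (a g x) = b g (f x))"

(* the free module Z[G]^n, realised as finitely supported functions {0..<n} x G -> Z *)
definition free_ZG :: "('g, 'e) monoid_scheme \<Rightarrow> nat \<Rightarrow> (nat \<Rightarrow> 'g \<Rightarrow> int) set" where
  "free_ZG G n = {v. (\<forall>i h. (i \<ge> n \<or> h \<notin> carrier G) \<longrightarrow> v i h = 0) \<and>
                     finite {(i, h). v i h \<noteq> 0}}"

definition free_ZG_act :: "('g, 'e) monoid_scheme \<Rightarrow> 'g \<Rightarrow> (nat \<Rightarrow> 'g \<Rightarrow> int) \<Rightarrow> (nat \<Rightarrow> 'g \<Rightarrow> int)" where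
  "free_ZG_act G g v = (\<lambda>i h. if h \<in> carrier G then v i (inv\<^bsub>G\<^esub> g \<otimes>\<^bsub>G\<^esub> h) else 0)"

(* finitely generated projective = direct summand of some Z[G]^n *)
definition fg_projective :: "('g, 'e) monoid_scheme \<Rightarrow> 'm::ab_group_add set \<Rightarrow> ('g \<Rightarrow> 'm \<Rightarrow> 'm) \<Rightarrow> bool" where
  "fg_projective G P a \<longleftrightarrow> ZG_module G P a \<and>
     (\<exists>n i r. ZG_linear G P a (free_ZG G n) (free_ZG_act G) i \<and>
              ZG_linear G (free_ZG G n) (free_ZG_act G) P a r \<and>
              (\<forall>x\<in>P. r (i x) = x))"

definition FP2_resolution :: "('g, 'e) monoid_scheme
    \<Rightarrow> 'p0::ab_group_add set \<Rightarrow> ('g \<Rightarrow> 'p0 \<Rightarrow> 'p0)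
    \<Rightarrow> 'p1::ab_group_add set \<Rightarrow> ('g \<Rightarrow> 'p1 \<Rightarrow> 'p1)
    \<Rightarrow> 'p2::ab_group_add set \<Rightarrow> ('g \<Rightarrow> 'p2 \<Rightarrow> 'p2)
    \<Rightarrow> ('p0 \<Rightarrow> int) \<Rightarrow> ('p1 \<Rightarrow> 'p0) \<Rightarrow> ('p2 \<Rightarrow> 'p1) \<Rightarrow> bool" where
  "FP2_resolution G P0 a0 P1 a1 P2 a2 e d1 d2 \<longleftrightarrow>
     fg_projective G P0 a0 \<and> fg_projective G P1 a1 \<and> fg_projective G P2 a2 \<and>
     ZG_linear G P0 a0 UNIV (\<lambda>g k. k) e \<and>
     ZG_linear G P1 a1 P0 a0 d1 \<and> ZG_linear G P2 a2 P1 a1 d2 \<and>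
     e ` P0 = UNIV \<and>
     {x\<in>P0. e x = 0} = d1 ` P1 \<and>
     {x\<in>P1. d1 x = 0} = d2 ` P2"

definition letter_val :: "('g, 'e) monoid_scheme \<Rightarrow> 'g \<times> bool \<Rightarrow> 'g" where
  "letter_val G l = (if snd l then fst l else inv\<^bsub>G\<^esub> (fst l))"

definition finitely_presented :: "('g, 'e) monoid_scheme \<Rightarrow> bool" where
  "finitely_presented G \<longleftrightarrow>
     (\<exists>X R. finite X \<and> X \<subseteq> carrier G \<and> finite R \<and>
        (\<forall>r\<in>R. fst ` set r \<subseteq> X \<and> word_prod G (map (letter_val G) r) = \<one>\<^bsub>G\<^esub>) \<and>
        carrier G = {word_prod G (map (letter_val G) w) | w. fst ` set w \<subseteq> X} \<and>
        (\<forall>w. fst ` set w \<subseteq> X \<and> word_prod G (map (letter_val G) w) = \<one>\<^bsub>G\<^esub> \<longrightarrow>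
           word_cong (R \<union> {[(x, b), (x, \<not> b)] | x b. x \<in> X}) w []))"

end

theory Submission
  imports Defs "HOL-Library.Z2" "HOL-Library.Poly_Mapping"
begin

text \<open>Being of type \<open>FP\<^sub>2\<close>, like being finitely presented, forces every integral 1-cocycle on \<open>G\<close>
  that is defined up to a large enough scale to be a coboundary on a given smaller scale.  To refute
  this, let \<open>G\<close> act on pairs of opposite chambers, a transitive action with finite stabilisers.
  Since \<open>m(s,t) = \<infinity>\<close> and \<open>S = {s,t,u}\<close>, the group \<open>W\<close> is an amalgam over \<open>\<langle>u\<rangle>\<close>, so each half of the
  twin building is separated by any of its \<open>u\<close>-panels.  A \<open>u\<close>-panel in each half gives two
  functions \<open>X\<close>, \<open>Y\<close> telling on which side of it a chamber lies, and the cup product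
  \<open>(X h - X g) * Y g\<close> is a cocycle on every scale on which no opposite pair is close to both panels,
  that is, whenever the codistance of the two panels is large.  On the other hand, starting from
  chambers at codistance \<open>sts...s\<close>, alternating galleries that branch in both halves produce a closed
  loop of opposite pairs, with steps of bounded size, around the two panels, and the cocycle
  does not vanish on it.\<close>

text \<open>A cocycle defined on all pairs of \<open>G\<close> is a coboundary, with primitive
  \<open>c \<one> g\<close>, so the whole content lies in the order of the scales. The steps of the
  loop fix \<open>F\<close>, the finiteness property then hands over \<open>F'\<close>, and only
  afterwards is the codistance of the two panels chosen, large against \<open>F'\<close>. If
  \<open>L\<close> bounds how far \<open>F'\<close> moves the base pair, a change of side happens
  only within \<open>L + 2\<close> of the chosen chamber of the panel, because the boundary of
  \<open>H\<close> consists of elements of length at most two. A codistance above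
  \<open>2 * L + 4\<close> therefore keeps the two changes apart. For the loop, two galleries in
  each half give four paths of opposite pairs. On a coboundary, the sum along such a path is a
  function of one gallery minus a function of the other, so its alternating sum over the four
  choices is zero; the cup product gives one for one choice and zero for the other three. On the
  algebraic side the bar complex is not finitely generated. The set \<open>F'\<close> is finite
  because only finitely many chains in it have to be filled.\<close>

lemma word_prod_Nil [simp]: "word_prod G [] = \<one>\<^bsub>G\<^esub>"
  by (simp add: word_prod_def)

lemma word_prod_Cons [simp]: "word_prod G (x # w) = x \<otimes>\<^bsub>G\<^esub> word_prod G w"
  by (simp add: word_prod_def)

lemma (in monoid) word_prod_closed [intro]: "set w \<subseteq> carrier G \<Longrightarrow> word_prod G w \<in> carrier G"
  by (induction w) auto

lemma (in monoid) word_prod_append: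
  "set v \<subseteq> carrier G \<Longrightarrow> set w \<subseteq> carrier G \<Longrightarrow> word_prod G (v @ w) = word_prod G v \<otimes> word_prod G w"
  by (induction v) (auto simp: m_assoc word_prod_closed)

lemma (in group) word_prod_rev:
  assumes "\<And>x. x \<in> set w \<Longrightarrow> x \<in> carrier G \<and> x \<otimes> x = \<one>"
  shows "word_prod G (rev w) = inv (word_prod G w)"
  using assms
proof (induction w)
  case (Cons a w)
  have "inv a = a" using Cons.prems[of a] by (auto intro: inv_equality)
  moreover have "set w \<subseteq> carrier G" "a \<in> carrier G" using Cons.prems by auto
  moreover have "word_prod G w \<in> carrier G" using \<open>set w \<subseteq> carrier G\<close> by auto
  ultimately show ?case using Cons by (simp add: word_prod_append inv_mult_group)
qed auto

section \<open>Edge labels of a Cayley graph, summed along words\<close>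

fun path_sum :: "('g, 'e) monoid_scheme \<Rightarrow> ('l \<Rightarrow> 'g) \<Rightarrow> ('g \<Rightarrow> 'l \<Rightarrow> 'a::ab_group_add) \<Rightarrow> 'g \<Rightarrow> 'l list \<Rightarrow> 'a"
  where
  "path_sum G val \<kappa> g [] = 0"
| "path_sum G val \<kappa> g (l # w) = \<kappa> g l + path_sum G val \<kappa> (g \<otimes>\<^bsub>G\<^esub> val l) w"

lemma (in group) path_sum_append:
  assumes "val ` set u \<subseteq> carrier G" "g \<in> carrier G" "val ` set v \<subseteq> carrier G"
  shows "path_sum G val \<kappa> g (u @ v)
    = path_sum G val \<kappa> g u + path_sum G val \<kappa> (g \<otimes> word_prod G (map val u)) v"
  using assms(1,2)
proof (induction u arbitrary: g)
  case (Cons a u)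
  have "word_prod G (map val u) \<in> carrier G" using Cons.prems by (intro word_prod_closed) auto
  thus ?case using Cons by (simp add: m_assoc add.assoc)
qed auto

text \<open>\<open>word_cong\<close> ranges over words in arbitrary letters, so an intermediate word
  of a derivation might leave \<open>X\<close>. The first conjunct rules this out, which is what
  lets the two induction hypotheses compose in the transitive case.\<close>

lemma (in group) word_cong_path_sum:
  fixes \<kappa> :: "'a \<Rightarrow> 'l \<Rightarrow> 'v::ab_group_add"
  assumes "word_cong R u v" and val: "val ` X \<subseteq> carrier G"
    and R: "\<And>r. r \<in> R \<Longrightarrow> set r \<subseteq> X \<and> word_prod G (map val r) = \<one> \<and>
                      (\<forall>g\<in>carrier G. path_sum G val \<kappa> g r = 0)"
  shows "(set u \<subseteq> X \<longleftrightarrow> set v \<subseteq> X) \<and>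
    (set u \<subseteq> X \<longrightarrow> (\<forall>g\<in>carrier G. path_sum G val \<kappa> g u = path_sum G val \<kappa> g v))"
  using assms(1)
proof induction
  case (wc_step r u v)
  have "path_sum G val \<kappa> g (u @ r @ v) = path_sum G val \<kappa> g (u @ v)"
    if "set u \<subseteq> X" "set v \<subseteq> X" "g \<in> carrier G" for g
  proof -
    have c: "val ` set u \<subseteq> carrier G" "val ` set v \<subseteq> carrier G" "val ` set r \<subseteq> carrier G"
      "val ` set (r @ v) \<subseteq> carrier G"
      using that(1,2) val R[OF wc_step] by fastforce+
    have "word_prod G (map val u) \<in> carrier G"
      using c by (intro word_prod_closed) auto
    with that c R[OF wc_step] show ?thesis by (simp add: path_sum_append del: set_append)
  qed
  with R[OF wc_step] show ?case by auto
qed auto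

text \<open>\<open>pres\<close> speaks only of words with product one, and \<open>\<kappa>\<close>
  may fail to change sign when an edge is walked backwards, so inverting one of the two words is no
  way to compare them. Instead both are closed up by the same word \<open>w\<close>, which starts at
  the same vertex in both cases, and its contribution cancels.\<close>

lemma (in group) path_sum_determined:
  fixes \<kappa> :: "'a \<Rightarrow> 'l \<Rightarrow> 'v::ab_group_add"
  assumes val: "val ` X \<subseteq> carrier G"
    and R: "\<And>r. r \<in> R \<Longrightarrow> set r \<subseteq> X \<and> word_prod G (map val r) = \<one> \<and>
                      (\<forall>g\<in>carrier G. path_sum G val \<kappa> g r = 0)"
    and gen: "carrier G \<subseteq> {word_prod G (map val w) | w. set w \<subseteq> X}"
    and pres: "\<And>w. set w \<subseteq> X \<Longrightarrow> word_prod G (map val w) = \<one> \<Longrightarrow> word_cong R w []"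
    and u: "set u \<subseteq> X" and v: "set v \<subseteq> X"
    and eq: "word_prod G (map val u) = word_prod G (map val v)" and g: "g \<in> carrier G"
  shows "path_sum G val \<kappa> g u = path_sum G val \<kappa> g v"
proof -
  have cu: "word_prod G (map val u) \<in> carrier G"
    using u val by (intro word_prod_closed) auto
  then obtain w where w: "set w \<subseteq> X" "inv (word_prod G (map val u)) = word_prod G (map val w)"
    using gen by (smt (verit) inv_closed mem_Collect_eq subset_iff)
  have *: "path_sum G val \<kappa> g z + path_sum G val \<kappa> (g \<otimes> word_prod G (map val u)) w = 0"
    if z: "set z \<subseteq> X" "word_prod G (map val z) = word_prod G (map val u)" for z
  proof -
    have sz: "set (map val z) \<subseteq> carrier G" "set (map val w) \<subseteq> carrier G" using z w val by auto
    have "word_prod G (map val (z @ w)) = \<one>"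
      using word_prod_append[OF sz] z w(2)[symmetric] cu by simp
    hence "word_cong R (z @ w) []" using pres z w by simp
    from word_cong_path_sum[OF this val R] have "path_sum G val \<kappa> g (z @ w) = 0"
      using z w g by simp
    thus ?thesis using path_sum_append[of val z g w \<kappa>] sz z g by simp
  qed
  show ?thesis using *[of u] *[of v] u v eq by (metis add_right_cancel)
qed

section \<open>Local cocycles\<close>

text \<open>The function \<open>c\<close> is not assumed invariant under \<open>G\<close>. Only the
  two consecutive increments are short; the equation then governs \<open>c g k\<close> at increments
  up to products of two elements of \<open>F\<close>.\<close>

definition local_cocycle :: "('g, 'e) monoid_scheme \<Rightarrow> 'g set \<Rightarrow> ('g \<Rightarrow> 'g \<Rightarrow> int) \<Rightarrow> bool" where
  "local_cocycle G F c \<longleftrightarrow> (\<forall>g\<in>carrier G. \<forall>h\<in>carrier G. \<forall>k\<in>carrier G.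
     inv\<^bsub>G\<^esub> g \<otimes>\<^bsub>G\<^esub> h \<in> F \<and> inv\<^bsub>G\<^esub> h \<otimes>\<^bsub>G\<^esub> k \<in> F \<longrightarrow> c g h + c h k = c g k)"

text \<open>A coarse vanishing of first cohomology: what is a cocycle at the large scale becomes a
  coboundary at the small one. It matters that \<open>F'\<close> is chosen before
  \<open>c\<close>.\<close>

definition local_cocycles_trivial :: "('g, 'e) monoid_scheme \<Rightarrow> bool" where
  "local_cocycles_trivial G \<longleftrightarrow> (\<forall>F. finite F \<and> F \<subseteq> carrier G \<longrightarrow>
     (\<exists>F'. finite F' \<and> F' \<subseteq> carrier G \<and> (\<forall>c. local_cocycle G F' c \<longrightarrow>
        (\<exists>a. \<forall>g\<in>carrier G. \<forall>k\<in>F. c g (g \<otimes>\<^bsub>G\<^esub> k) = a (g \<otimes>\<^bsub>G\<^esub> k) - a g))))"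

lemma (in group) local_cocycleD:
  assumes "local_cocycle G F c" "g \<in> carrier G" "h \<in> F" "k \<in> F" "F \<subseteq> carrier G"
  shows "c g (g \<otimes> h) + c (g \<otimes> h) (g \<otimes> h \<otimes> k) = c g (g \<otimes> h \<otimes> k)"
proof -
  have [simp]: "h \<in> carrier G" "k \<in> carrier G" using assms by auto
  have "inv g \<otimes> (g \<otimes> h) = h" using assms by (simp add: m_assoc[symmetric])
  moreover have "inv (g \<otimes> h) \<otimes> (g \<otimes> h \<otimes> k) = k"
    using assms by (metis \<open>h \<in> carrier G\<close> \<open>k \<in> carrier G\<close> inv_closed l_inv l_one m_assoc m_closed)
  ultimately show ?thesis using assms unfolding local_cocycle_def by auto
qed

text \<open>Appending a letter uses the cocycle equation for the base point, the end of the prefix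
  and the new end. Its two increments are the product of the prefix and the last letter, hence the
  conditions \<open>pre\<close> and \<open>val\<close>.\<close>

lemma (in group) path_sum_local_cocycle:
  assumes c: "local_cocycle G F c" and F: "F \<subseteq> carrier G" and one: "\<one> \<in> F" and val: "val ` X \<subseteq> F"
    and w: "set w \<subseteq> X" and pre: "\<And>n. word_prod G (map val (take n w)) \<in> F" and g: "g \<in> carrier G"
  shows "path_sum G val (\<lambda>g l. c g (g \<otimes> val l)) g w = c g (g \<otimes> word_prod G (map val w))"
  using w pre
proof (induction w rule: rev_induct)
  case Nil
  show ?case using local_cocycleD[OF c g one one F] g by simp
next
  case (snoc l w)
  have sw: "set w \<subseteq> X" and l: "val l \<in> F" using snoc.prems val by auto
  have *: "word_prod G (map val (take n w)) \<in> F" for n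
    using snoc.prems(2)[of "min n (length w)"] by (cases "n \<le> length w") (auto simp: min_def)
  hence w_in: "word_prod G (map val w) \<in> F" by (metis order_refl take_all)
  have sc: "val ` set w \<subseteq> carrier G" "val ` set [l] \<subseteq> carrier G" "val l \<in> carrier G"
    using sw l val F by auto
  have "word_prod G (map val w) \<in> carrier G" using w_in F by auto
  moreover have "word_prod G (map val (w @ [l])) = word_prod G (map val w) \<otimes> val l"
    using word_prod_append[of "map val w" "[val l]"] sc by simp
  ultimately show ?case
    using local_cocycleD[OF c g w_in l F] snoc.IH[OF sw *] sc g
    by (simp add: path_sum_append m_assoc)
qed

lemma (in group) finitely_presented_imp_local_cocycles_trivial:
  assumes "finitely_presented G"
  shows "local_cocycles_trivial G"
  unfolding local_cocycles_trivial_def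
proof (intro allI impI, elim conjE)
  fix F assume "finite F" "F \<subseteq> carrier G"
  obtain X R where XR: "finite X \<and> X \<subseteq> carrier G \<and> finite R \<and>
        (\<forall>r\<in>R. fst ` set r \<subseteq> X \<and> word_prod G (map (letter_val G) r) = \<one>) \<and>
        carrier G = {word_prod G (map (letter_val G) w) | w. fst ` set w \<subseteq> X} \<and>
        (\<forall>w. fst ` set w \<subseteq> X \<and> word_prod G (map (letter_val G) w) = \<one> \<longrightarrow>
           word_cong (R \<union> {[(x, b), (x, \<not> b)] | x b. x \<in> X}) w [])"
    using assms unfolding finitely_presented_def by (elim exE) (rule that)
  note X = XR[THEN conjunct1] XR[THEN conjunct2, THEN conjunct1]
  note X3 = XR[THEN conjunct2, THEN conjunct2]
  have "finite R" by (rule X3[THEN conjunct1])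
  note R = X3[THEN conjunct2, THEN conjunct1, rule_format]
  note gen = X3[THEN conjunct2, THEN conjunct2, THEN conjunct1]
  note pres = X3[THEN conjunct2, THEN conjunct2, THEN conjunct2, rule_format]
  define val where "val = letter_val G"
  define L where "L = X \<times> (UNIV :: bool set)"
  define R' where "R' = R \<union> {[(x, b), (x, \<not> b)] | x b. x \<in> X}"
  have L: "fst ` set w \<subseteq> X \<longleftrightarrow> set w \<subseteq> L" for w :: "('a \<times> bool) list"
    unfolding L_def by (force simp: subset_iff)
  have val: "val ` L \<subseteq> carrier G"
    using X by (auto simp: val_def L_def letter_val_def)
  have R'L: "set r \<subseteq> L \<and> word_prod G (map val r) = \<one>" if "r \<in> R'" for r
    using that R X unfolding R'_def val_def L[symmetric] by (auto simp: letter_val_def)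
  have "\<exists>w. set w \<subseteq> L \<and> g = word_prod G (map val w)" if "g \<in> carrier G" for g
    using that unfolding gen L val_def by auto
  then obtain wd where wd: "\<And>g. g \<in> carrier G \<Longrightarrow> set (wd g) \<subseteq> L \<and> g = word_prod G (map val (wd g))"
    by metis
  define pref where "pref r = (\<lambda>n. word_prod G (map val (take n r))) ` {..length r}" for r
  have pref: "word_prod G (map val (take n r)) \<in> pref r" for n r
    unfolding pref_def by (cases "n \<le> length r") (auto intro!: image_eqI[of _ _ "length r"])
  \<comment> \<open>Each part has its purpose: \<open>\<one>\<close> gives \<open>c g g = 0\<close>,
    the letters are single steps, the prefixes of relators make their path sums vanish, and the
    prefixes of \<open>wd k\<close> turn the path sum along \<open>wd k\<close> into
    \<open>c g (g \<otimes> k)\<close>.\<close>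
  define F' where "F' = {\<one>} \<union> val ` L \<union> (\<Union>r\<in>R'. pref r) \<union> (\<Union>k\<in>F. pref (wd k))"
  have "R' = R \<union> (\<lambda>(x, b). [(x, b), (x, \<not> b)]) ` L" unfolding R'_def L_def by auto
  moreover have "finite L" using X by (simp add: L_def)
  ultimately have "finite F'"
    unfolding F'_def pref_def using \<open>finite R\<close> \<open>finite F\<close> by auto
  have prefc: "pref r \<subseteq> carrier G" if "set r \<subseteq> L" for r
  proof -
    have "set (map val (take n r)) \<subseteq> carrier G" for n
      using that val set_take_subset[of n r] by auto
    thus ?thesis unfolding pref_def by (auto intro!: word_prod_closed simp del: set_map)
  qed
  have "F' \<subseteq> carrier G"
  proof -
    have "pref r \<subseteq> carrier G" if "r \<in> R'" for r using prefc R'L[OF that] by simp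
    moreover have "pref (wd k) \<subseteq> carrier G" if "k \<in> F" for k
      using prefc wd[of k] that \<open>F \<subseteq> carrier G\<close> by auto
    ultimately show ?thesis unfolding F'_def using val by auto
  qed
  show "\<exists>F'. finite F' \<and> F' \<subseteq> carrier G \<and> (\<forall>c. local_cocycle G F' c \<longrightarrow>
        (\<exists>a. \<forall>g\<in>carrier G. \<forall>k\<in>F. c g (g \<otimes> k) = a (g \<otimes> k) - a g))"
  proof (intro exI[of _ F'] conjI allI impI)
    fix c assume c: "local_cocycle G F' c"
    let ?p = "path_sum G val (\<lambda>g l. c g (g \<otimes> val l))"
    have eval: "?p g w = c g (g \<otimes> word_prod G (map val w))"
      if "set w \<subseteq> L" "pref w \<subseteq> F'" "g \<in> carrier G" for g w
    proof (rule path_sum_local_cocycle[OF c \<open>F' \<subseteq> carrier G\<close> _ _ that(1) _ that(3)])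
      show "\<one> \<in> F'" "val ` L \<subseteq> F'" by (auto simp: F'_def)
      show "word_prod G (map val (take n w)) \<in> F'" for n using that(2) pref by blast
    qed
    have c1: "c g g = 0" if "g \<in> carrier G" for g
      using local_cocycleD[OF c that _ _ \<open>F' \<subseteq> carrier G\<close>, of \<one> \<one>] that by (simp add: F'_def)
    have rel: "set r \<subseteq> L \<and> word_prod G (map val r) = \<one> \<and> (\<forall>g\<in>carrier G. ?p g r = 0)" if "r \<in> R'" for r
    proof -
      have "pref r \<subseteq> F'" using that by (auto simp: F'_def)
      thus ?thesis using R'L[OF that] eval[of r] c1 by auto
    qed
    have det: "?p \<one> u = ?p \<one> v"
      if "set u \<subseteq> L" "set v \<subseteq> L" "word_prod G (map val u) = word_prod G (map val v)" for u v
    proof (rule path_sum_determined[OF val rel _ _ that one_closed])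
      show "carrier G \<subseteq> {word_prod G (map val w) |w. set w \<subseteq> L}"
        using gen unfolding L val_def by simp
      show "word_cong R' w []" if "set w \<subseteq> L" "word_prod G (map val w) = \<one>" for w
        using that pres[of w] unfolding L val_def R'_def by simp
    qed
    show "\<exists>a. \<forall>g\<in>carrier G. \<forall>k\<in>F. c g (g \<otimes> k) = a (g \<otimes> k) - a g"
    \<comment> \<open>The primitive integrates \<open>c\<close> from \<open>\<one>\<close> to
      \<open>g\<close> along the chosen word. By \<open>det\<close>, the word chosen for
      \<open>g \<otimes> k\<close> may be exchanged for \<open>wd g @ wd k\<close>.\<close>
    proof (intro exI[of _ "\<lambda>g. ?p \<one> (wd g)"] ballI)
      fix g k assume g: "g \<in> carrier G" and k: "k \<in> F"
      hence kc: "k \<in> carrier G" using \<open>F \<subseteq> carrier G\<close> by auto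
      note w = wd[OF g] wd[OF kc] wd[OF m_closed[OF g kc]]
      have s: "val ` set (wd g) \<subseteq> carrier G" "val ` set (wd k) \<subseteq> carrier G"
        using w val by (meson image_mono order_trans)+
      have "word_prod G (map val (wd g @ wd k)) = g \<otimes> k"
        using word_prod_append[of "map val (wd g)" "map val (wd k)"] s w by simp
      hence "?p \<one> (wd (g \<otimes> k)) = ?p \<one> (wd g @ wd k)"
        using w by (intro det) auto
      also have "\<dots> = ?p \<one> (wd g) + ?p g (wd k)"
        using s w g by (simp add: path_sum_append)
      also have "?p g (wd k) = c g (g \<otimes> k)"
        using eval[of "wd k" g] w k g by (auto simp: F'_def)
      finally show "c g (g \<otimes> k) = ?p \<one> (wd (g \<otimes> k)) - ?p \<one> (wd g)" by simp
    qed
  qed (use \<open>finite F'\<close> \<open>F' \<subseteq> carrier G\<close> in auto)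
qed

section \<open>Modules over the group ring\<close>

lemma ZG_module_diff: "ZG_module G M a \<Longrightarrow> x \<in> M \<Longrightarrow> y \<in> M \<Longrightarrow> x - y \<in> M"
  unfolding ZG_module_def by (metis add_uminus_conv_diff)

lemma additive_zero: "f (0 + 0) = f 0 + f 0 \<Longrightarrow> f (0 :: 'b::ab_group_add) = (0 :: 'a::ab_group_add)"
  by simp

lemma ZG_linear_zero:
  assumes "ZG_module G M a" "ZG_linear G M a N b f"
  shows "f 0 = 0"
  using assms additive_zero[of f] unfolding ZG_module_def ZG_linear_def by blast

lemma ZG_linear_diff:
  assumes "ZG_module G M a" "ZG_linear G M a N b f" "x \<in> M" "y \<in> M"
  shows "f (x - y) = f x - f y"
proof -
  have "x - y \<in> M" using assms ZG_module_diff by blast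
  hence "f (x - y + y) = f (x - y) + f y"
    using assms(2,4) unfolding ZG_linear_def by blast
  thus ?thesis by simp
qed

lemma ZG_linear_closed: "ZG_linear G M a N b f \<Longrightarrow> x \<in> M \<Longrightarrow> f x \<in> N"
  by (simp add: ZG_linear_def)

lemma ZG_linear_act: "ZG_linear G M a N b f \<Longrightarrow> g \<in> carrier G \<Longrightarrow> x \<in> M \<Longrightarrow> f (a g x) = b g (f x)"
  by (simp add: ZG_linear_def)

lemma ZG_linear_comp:
  "ZG_linear G M a N b f \<Longrightarrow> ZG_linear G N b L c h \<Longrightarrow> ZG_linear G M a L c (\<lambda>x. h (f x))"
  by (simp add: ZG_linear_def)

definition frag_map :: "('x \<Rightarrow> 'y) \<Rightarrow> ('x \<Rightarrow>\<^sub>0 int) \<Rightarrow> 'y \<Rightarrow>\<^sub>0 int" where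
  "frag_map f = frag_extend (\<lambda>x. frag_of (f x))"

lemma frag_map_simps [simp]:
  "frag_map f 0 = 0" "frag_map f (frag_of x) = frag_of (f x)"
  "frag_map f (v + w) = frag_map f v + frag_map f w"
  "frag_map f (v - w) = frag_map f v - frag_map f w"
  by (auto simp: frag_map_def frag_extend_add frag_extend_diff)

definition frags_on :: "'x set \<Rightarrow> ('x \<Rightarrow>\<^sub>0 int) set" where
  "frags_on X = {v. Poly_Mapping.keys v \<subseteq> X}"

lemma frags_on_closed [simp]:
  "0 \<in> frags_on X" "v \<in> frags_on X \<Longrightarrow> w \<in> frags_on X \<Longrightarrow> v + w \<in> frags_on X"
  "v \<in> frags_on X \<Longrightarrow> w \<in> frags_on X \<Longrightarrow> v - w \<in> frags_on X"
  "v \<in> frags_on X \<Longrightarrow> - v \<in> frags_on X"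
  "frag_of x \<in> frags_on X \<longleftrightarrow> x \<in> X"
  using keys_add[of v w] keys_diff[of v w] by (auto simp: frags_on_def keys_frag_of)

lemma frags_on_induct [consumes 1, case_names zero one diff]:
  assumes "v \<in> frags_on X" "P 0" "\<And>x. x \<in> X \<Longrightarrow> P (frag_of x)"
    "\<And>v w. v \<in> frags_on X \<Longrightarrow> w \<in> frags_on X \<Longrightarrow> P v \<Longrightarrow> P w \<Longrightarrow> P (v - w)"
  shows "P v"
proof -
  have "v \<in> frags_on X \<and> P v"
    by (rule frag_induction[of v X]) (use assms in \<open>auto simp: frags_on_def[symmetric]\<close>, auto simp: frags_on_def)
  thus ?thesis by simp
qed

lemma frag_extend_on:
  assumes "v \<in> frags_on X" "\<And>x. x \<in> X \<Longrightarrow> f x \<in> frags_on Y"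
  shows "frag_extend f v \<in> frags_on Y"
  using assms(1) by (induction rule: frags_on_induct) (auto simp: frag_extend_diff assms(2))

lemma frag_map_on: "v \<in> frags_on X \<Longrightarrow> (\<And>x. x \<in> X \<Longrightarrow> f x \<in> Y) \<Longrightarrow> frag_map f v \<in> frags_on Y"
  unfolding frag_map_def by (erule frag_extend_on) simp

lemma permutation_module:
  assumes "\<And>g x. g \<in> carrier G \<Longrightarrow> x \<in> X \<Longrightarrow> act g x \<in> X" "\<And>x. x \<in> X \<Longrightarrow> act \<one>\<^bsub>G\<^esub> x = x"
    and "\<And>g h x. g \<in> carrier G \<Longrightarrow> h \<in> carrier G \<Longrightarrow> x \<in> X \<Longrightarrow> act (g \<otimes>\<^bsub>G\<^esub> h) x = act g (act h x)"
  shows "ZG_module G (frags_on X) (\<lambda>g. frag_map (act g))"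
  unfolding ZG_module_def
proof (intro conjI ballI)
  fix v assume v: "v \<in> frags_on X"
  show "frag_map (act \<one>\<^bsub>G\<^esub>) v = v"
    using v by (induction rule: frags_on_induct) (auto simp: assms)
  fix g assume g: "g \<in> carrier G"
  thus "frag_map (act g) v \<in> frags_on X" using v assms by (auto intro: frag_map_on)
  fix h assume h: "h \<in> carrier G"
  show "frag_map (act (g \<otimes>\<^bsub>G\<^esub> h)) v = frag_map (act g) (frag_map (act h) v)"
    using v by (induction rule: frags_on_induct) (auto simp: assms g h)
qed auto

text \<open>Translates \<open>free_ZG\<close> into formal sums, the language of the infinite-rank
  bar modules, where equivariant maps can be defined on a basis and checked by
  \<open>frags_on_induct\<close>.\<close>

lemma (in group) fg_projective_frags_on:
  assumes "fg_projective G P a"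
  obtains n \<iota> \<rho> where
    "ZG_linear G P a (frags_on ({..<n::nat} \<times> carrier G)) (\<lambda>g. frag_map (\<lambda>(j, h). (j, g \<otimes> h))) \<iota>"
    "ZG_linear G (frags_on ({..<n} \<times> carrier G)) (\<lambda>g. frag_map (\<lambda>(j, h). (j, g \<otimes> h))) P a \<rho>"
    "\<And>x. x \<in> P \<Longrightarrow> \<rho> (\<iota> x) = x"
proof -
  obtain n i r where i: "ZG_linear G P a (free_ZG G n) (free_ZG_act G) i"
    and r: "ZG_linear G (free_ZG G n) (free_ZG_act G) P a r" and ri: "\<And>x. x \<in> P \<Longrightarrow> r (i x) = x"
    using assms unfolding fg_projective_def by blast
  let ?B = "{..<n} \<times> carrier G" and ?sh = "\<lambda>g. frag_map (\<lambda>(j, h). (j, g \<otimes> h))"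
  define tofree where "tofree w = (\<lambda>i h. Poly_Mapping.lookup w (i, h))" for w :: "nat \<times> 'a \<Rightarrow>\<^sub>0 int"
  define ofree where "ofree v = Abs_poly_mapping (\<lambda>(i, h). v i h)" for v :: "nat \<Rightarrow> 'a \<Rightarrow> int"
  have fin: "finite {x. (case x of (i, h) \<Rightarrow> v i h) \<noteq> 0}" if "v \<in> free_ZG G n" for v :: "nat \<Rightarrow> 'a \<Rightarrow> int"
    using that by (simp add: free_ZG_def case_prod_beta')
  have lookup_ofree: "Poly_Mapping.lookup (ofree v) (i, h) = v i h" if "v \<in> free_ZG G n" for v i h
    unfolding ofree_def using lookup_Abs_poly_mapping fin[OF that]
    by (subst Abs_poly_mapping_inverse) (auto simp: case_prod_beta')
  have tofree_ofree: "tofree (ofree v) = v" if "v \<in> free_ZG G n" for v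
    using lookup_ofree[OF that] by (auto simp: tofree_def)
  have ofree_tofree: "ofree (tofree w) = w" for w
    unfolding ofree_def tofree_def by simp
  have tofree_in: "tofree w \<in> free_ZG G n" if "w \<in> frags_on ?B" for w
  proof -
    have "{(i, h). Poly_Mapping.lookup w (i, h) \<noteq> 0} = Poly_Mapping.keys w" by (auto simp: in_keys_iff)
    thus ?thesis using that unfolding free_ZG_def tofree_def frags_on_def by (auto simp flip: not_in_keys_iff_lookup_eq_zero)
  qed
  have ofree_in: "ofree v \<in> frags_on ?B" if "v \<in> free_ZG G n" for v
  proof -
    have "p \<in> {..<n} \<times> carrier G" if "p \<in> Poly_Mapping.keys (ofree v)" for p
    proof (cases p)
      case (Pair i h)
      hence "v i h \<noteq> 0" using that lookup_ofree[OF \<open>v \<in> free_ZG G n\<close>] by (simp add: in_keys_iff)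
      thus ?thesis using \<open>v \<in> free_ZG G n\<close> Pair by (auto simp: free_ZG_def not_le[symmetric])
    qed
    thus ?thesis unfolding frags_on_def by blast
  qed
  have tofree_add: "tofree (v + w) = tofree v + tofree w" for v w
    by (simp add: tofree_def lookup_add fun_eq_iff)
  have tofree_diff: "tofree (v - w) = tofree v - tofree w" for v w
    by (simp add: tofree_def lookup_minus fun_eq_iff)
  have act_diff: "free_ZG_act G g (v - w) = free_ZG_act G g v - free_ZG_act G g w" for g v w
    by (auto simp: free_ZG_act_def fun_eq_iff)
  have tofree_act: "tofree (?sh g w) = free_ZG_act G g (tofree w)" if "w \<in> frags_on ?B" "g \<in> carrier G" for g w
    using that(1)
  proof (induction rule: frags_on_induct)
    case (one x)
    then obtain j h where x: "x = (j, h)" "h \<in> carrier G" by auto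
    have "k = g \<otimes> h \<longleftrightarrow> inv g \<otimes> k = h" if "k \<in> carrier G" for k
      using that \<open>g \<in> carrier G\<close> x(2) by (metis inv_solve_left')
    with x \<open>g \<in> carrier G\<close> show ?case
      by (auto simp: tofree_def free_ZG_act_def fun_eq_iff)
  qed (auto simp: tofree_diff act_diff, auto simp: tofree_def free_ZG_act_def fun_eq_iff)
  show thesis
  proof (rule that[of n "\<lambda>x. ofree (i x)" "\<lambda>w. r (tofree w)"])
    show "ZG_linear G P a (frags_on ?B) ?sh (\<lambda>x. ofree (i x))"
      unfolding ZG_linear_def
    proof (intro conjI ballI)
      fix x assume x: "x \<in> P"
      hence ix: "i x \<in> free_ZG G n" using i by (simp add: ZG_linear_def)
      thus "ofree (i x) \<in> frags_on ?B" by (rule ofree_in)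
      show "ofree (i (x + y)) = ofree (i x) + ofree (i y)" if y: "y \<in> P" for y
      proof -
        have "i y \<in> free_ZG G n" "i (x + y) = i x + i y" using i x y by (simp_all add: ZG_linear_def)
        hence "tofree (ofree (i x) + ofree (i y)) = i (x + y)" by (simp add: tofree_add tofree_ofree ix)
        thus ?thesis by (metis ofree_tofree)
      qed
      show "ofree (i (a g x)) = ?sh g (ofree (i x))" if g: "g \<in> carrier G" for g
      proof -
        have "tofree (?sh g (ofree (i x))) = i (a g x)"
          using tofree_act[OF ofree_in[OF ix] g] i x g by (simp add: tofree_ofree ix ZG_linear_def)
        thus ?thesis by (metis ofree_tofree)
      qed
    qed
    show "ZG_linear G (frags_on ?B) ?sh P a (\<lambda>w. r (tofree w))"
      using r tofree_in tofree_act unfolding ZG_linear_def by (auto simp: tofree_add)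
    show "r (tofree (ofree (i x))) = x" if "x \<in> P" for x
      using that i ri[OF that] by (simp add: tofree_ofree ZG_linear_def)
  qed
qed

text \<open>Stated with an inclusion of images so that it also lifts into a kernel:
  \<open>f0\<close> composed with \<open>d1\<close> lands in the kernel of the augmentation, which
  is what \<open>bd1\<close> reaches. One lifts the free generators, extends equivariantly and
  restricts to the summand \<open>P\<close> by \<open>\<iota>\<close>.\<close>

lemma (in group) projective_lift:
  fixes \<psi> :: "'p::ab_group_add \<Rightarrow> 'n::ab_group_add" and act :: "'a \<Rightarrow> 'x \<Rightarrow> 'x"
  assumes P: "fg_projective G P a"
    and act: "\<And>g x. g \<in> carrier G \<Longrightarrow> x \<in> X \<Longrightarrow> act g x \<in> X"
      "\<And>g h x. g \<in> carrier G \<Longrightarrow> h \<in> carrier G \<Longrightarrow> x \<in> X \<Longrightarrow> act (g \<otimes> h) x = act g (act h x)"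
    and mod: "ZG_module G (frags_on X) (\<lambda>g. frag_map (act g))"
    and D: "ZG_linear G (frags_on X) (\<lambda>g. frag_map (act g)) N b D"
    and \<psi>: "ZG_linear G P a N b \<psi>" and sub: "\<psi> ` P \<subseteq> D ` frags_on X"
  obtains f where "ZG_linear G P a (frags_on X) (\<lambda>g. frag_map (act g)) f" "\<And>x. x \<in> P \<Longrightarrow> D (f x) = \<psi> x"
proof -
  obtain n \<iota> \<rho> where
    \<iota>: "ZG_linear G P a (frags_on ({..<n::nat} \<times> carrier G)) (\<lambda>g. frag_map (\<lambda>(j, h). (j, g \<otimes> h))) \<iota>" and
    \<rho>: "ZG_linear G (frags_on ({..<n} \<times> carrier G)) (\<lambda>g. frag_map (\<lambda>(j, h). (j, g \<otimes> h))) P a \<rho>" and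
    \<rho>\<iota>: "\<And>x. x \<in> P \<Longrightarrow> \<rho> (\<iota> x) = x"
    using fg_projective_frags_on[OF P] by blast
  let ?B = "{..<n} \<times> carrier G" and ?sh = "\<lambda>g. frag_map (\<lambda>(j, h). (j, g \<otimes> h))"
  have mB: "ZG_module G (frags_on ?B) ?sh"
    by (rule permutation_module) (auto simp: m_assoc)
  have mP: "ZG_module G P a" using P by (simp add: fg_projective_def)
  have "\<exists>\<beta>\<in>frags_on X. D \<beta> = \<psi> (\<rho> (frag_of (j, \<one>)))" if "j < n" for j
  proof -
    have "\<rho> (frag_of (j, \<one>)) \<in> P" using \<rho> that by (simp add: ZG_linear_def)
    thus ?thesis using sub by (metis image_eqI imageE subset_iff)
  qed
  then obtain \<beta> where \<beta>: "\<And>j. j < n \<Longrightarrow> \<beta> j \<in> frags_on X" "\<And>j. j < n \<Longrightarrow> D (\<beta> j) = \<psi> (\<rho> (frag_of (j, \<one>)))"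
    by metis
  \<comment> \<open>Equivariance forces this formula, since \<open>(j, h)\<close> is the translate
    by \<open>h\<close> of \<open>(j, \<one>)\<close>.\<close>
  define \<Phi> where "\<Phi> = frag_extend (\<lambda>(j, h). frag_map (act h) (\<beta> j))"
  have \<Phi>: "\<Phi> w \<in> frags_on X" if "w \<in> frags_on ?B" for w
    unfolding \<Phi>_def using that
    by (rule frag_extend_on) (auto intro!: frag_map_on act \<beta>(1))
  have \<Phi>_act: "\<Phi> (?sh g w) = frag_map (act g) (\<Phi> w)" if "w \<in> frags_on ?B" "g \<in> carrier G" for g w
    using that(1)
  proof (induction rule: frags_on_induct)
    case (one x)
    then obtain j h where x: "x = (j, h)" "j < n" "h \<in> carrier G" by auto
    have "frag_map (act (g \<otimes> h)) v = frag_map (act g) (frag_map (act h) v)" if "v \<in> frags_on X" for v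
      using mod that x \<open>g \<in> carrier G\<close> by (simp add: ZG_module_def)
    with x \<beta>(1) show ?case by (simp add: \<Phi>_def)
  qed (auto simp: \<Phi>_def frag_extend_diff)
  have D\<Phi>: "D (\<Phi> w) = \<psi> (\<rho> w)" if "w \<in> frags_on ?B" for w
    using that
  proof (induction rule: frags_on_induct)
    case zero
    show ?case using ZG_linear_zero[OF mod D] ZG_linear_zero[OF mB \<rho>] ZG_linear_zero[OF mP \<psi>]
      by (simp add: \<Phi>_def)
  next
    case (one x)
    then obtain j h where x: "x = (j, h)" "j < n" "h \<in> carrier G" by auto
    have bj: "frag_of (j, \<one>) \<in> frags_on ?B" "\<rho> (frag_of (j, \<one>)) \<in> P" using \<rho> x by (simp_all add: ZG_linear_def)
    have "\<rho> (frag_of x) = a h (\<rho> (frag_of (j, \<one>)))"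
      using ZG_linear_act[OF \<rho> x(3) bj(1)] x by simp
    hence "\<psi> (\<rho> (frag_of x)) = b h (\<psi> (\<rho> (frag_of (j, \<one>))))"
      using \<psi> bj x by (simp add: ZG_linear_def)
    also have "\<dots> = D (frag_map (act h) (\<beta> j))"
      using D \<beta> x by (simp add: ZG_linear_def)
    finally show ?case by (simp add: \<Phi>_def x)
  next
    case (diff v w)
    have "D (\<Phi> v - \<Phi> w) = D (\<Phi> v) - D (\<Phi> w)" by (rule ZG_linear_diff[OF mod D]) (use diff \<Phi> in auto)
    moreover have "\<rho> (v - w) = \<rho> v - \<rho> w" by (rule ZG_linear_diff[OF mB \<rho>]) (use diff in auto)
    moreover have "\<psi> (\<rho> v - \<rho> w) = \<psi> (\<rho> v) - \<psi> (\<rho> w)"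
      by (rule ZG_linear_diff[OF mP \<psi>]) (use diff ZG_linear_closed[OF \<rho>] in auto)
    ultimately show ?case using diff by (simp add: \<Phi>_def frag_extend_diff)
  qed
  show thesis
  proof (rule that[of "\<lambda>x. \<Phi> (\<iota> x)"])
    show "ZG_linear G P a (frags_on X) (\<lambda>g. frag_map (act g)) (\<lambda>x. \<Phi> (\<iota> x))"
      using \<iota> \<Phi> \<Phi>_act unfolding ZG_linear_def by (auto simp: \<Phi>_def frag_extend_add)
    show "D (\<Phi> (\<iota> x)) = \<psi> x" if "x \<in> P" for x
      using that D\<Phi> \<iota> \<rho>\<iota> by (simp add: ZG_linear_def)
  qed
qed

section \<open>The bar complex\<close>

text \<open>The integral of \<open>c\<close> over a chain. \<open>frag_extend\<close> takes values
  in formal sums only, so integers appear as chains over the one-point type. The constant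
  \<open>c = 1\<close> gives the augmentation.\<close>

definition weight :: "('x \<Rightarrow> int) \<Rightarrow> ('x \<Rightarrow>\<^sub>0 int) \<Rightarrow> int" where
  "weight c v = Poly_Mapping.lookup (frag_extend (\<lambda>x. frag_cmul (c x) (frag_of ())) v) ()"

lemma weight_simps [simp]:
  "weight c 0 = 0" "weight c (frag_of x) = c x"
  "weight c (v + w) = weight c v + weight c w" "weight c (v - w) = weight c v - weight c w"
  by (auto simp: weight_def frag_extend_add frag_extend_diff lookup_add lookup_minus)

definition bd1 :: "('g \<times> 'g \<Rightarrow>\<^sub>0 int) \<Rightarrow> 'g \<Rightarrow>\<^sub>0 int" where
  "bd1 = frag_extend (\<lambda>(x, y). frag_of y - frag_of x)"

text \<open>With \<open>bd1\<close> this is the homogeneous bar complex in low degrees. The signs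
  are those of \<open>local_cocycle\<close>: the weight of this boundary vanishes on a triple
  exactly when the cocycle equation holds there.\<close>

definition bd2 :: "('g \<times> 'g \<times> 'g \<Rightarrow>\<^sub>0 int) \<Rightarrow> 'g \<times> 'g \<Rightarrow>\<^sub>0 int" where
  "bd2 = frag_extend (\<lambda>(x, y, z). frag_of (x, y) + frag_of (y, z) - frag_of (x, z))"

lemma bd_simps [simp]:
  "bd1 0 = 0" "bd1 (frag_of (x, y)) = frag_of y - frag_of x"
  "bd1 (p + q) = bd1 p + bd1 q" "bd1 (p - q) = bd1 p - bd1 q"
  "bd2 0 = 0" "bd2 (frag_of (x, y, z)) = frag_of (x, y) + frag_of (y, z) - frag_of (x, z)"
  "bd2 (v + w) = bd2 v + bd2 w" "bd2 (v - w) = bd2 v - bd2 w"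
  by (simp_all add: bd1_def bd2_def frag_extend_add frag_extend_diff)

text \<open>The bar complex is contracted by coning off at a vertex \<open>b\<close>. The cone does
  not commute with the action of \<open>G\<close>, so it only supplies preimages of individual
  chains; equivariance comes afterwards from \<open>projective_lift\<close> or by
  translating.\<close>

lemma cone0:
  assumes "v \<in> frags_on A" "weight (\<lambda>_. 1) v = 0" "b \<in> A"
  obtains w where "w \<in> frags_on (A \<times> A)" "bd1 w = v"
proof (rule that)
  show "frag_map (Pair b) v \<in> frags_on (A \<times> A)" using assms by (auto intro: frag_map_on)
  have "bd1 (frag_map (Pair b) v) = v - frag_cmul (weight (\<lambda>_. 1) v) (frag_of b)"
    using assms(1) by (induction rule: frags_on_induct) (auto simp: frag_cmul_diff_distrib)
  thus "bd1 (frag_map (Pair b) v) = v" using assms by simp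
qed

lemma cone1:
  assumes "v \<in> frags_on (A \<times> A)" "bd1 v = 0" "b \<in> A"
  obtains w where "w \<in> frags_on (A \<times> A \<times> A)" "bd2 w = v"
proof (rule that)
  show "frag_map (Pair b) v \<in> frags_on (A \<times> A \<times> A)" using assms by (auto intro: frag_map_on)
  have "bd2 (frag_map (Pair b) v) = v - frag_map (Pair b) (bd1 v)"
    using assms(1) by (induction rule: frags_on_induct) auto
  thus "bd2 (frag_map (Pair b) v) = v" using assms by simp
qed

lemma bd1_frags_on: "v \<in> frags_on (A \<times> A) \<Longrightarrow> bd1 v \<in> frags_on A"
  unfolding bd1_def by (erule frag_extend_on) auto

abbreviation diag1 where "diag1 f \<equiv> \<lambda>(x, y). (f x, f y)"

lemma bd1_equivariant: "bd1 (frag_map (diag1 f) v) = frag_map f (bd1 v)"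
  using frag_induction[of v UNIV "\<lambda>v. bd1 (frag_map (diag1 f) v) = frag_map f (bd1 v)"] by auto

lemma weight_frag_map: "weight c (frag_map f v) = weight (\<lambda>x. c (f x)) v"
  using frag_induction[of v UNIV "\<lambda>v. weight c (frag_map f v) = weight (\<lambda>x. c (f x)) v"] by auto

text \<open>The resolution is mapped to the bar complex in degrees zero and one only. In degree two
  it is enough to fill the images of the finitely many generators of \<open>P2\<close>; the supports
  of these fillings, together with one filling for each \<open>k\<close> in \<open>F\<close>,
  determine \<open>F'\<close>. A cocycle at scale \<open>F'\<close> then kills the image of
  \<open>d2\<close>, so on the image of \<open>f1\<close> its integral depends only on the boundary
  taken in \<open>P0\<close>.\<close>

theorem (in group) FP2_imp_local_cocycles_trivial:
  assumes "FP2_resolution G P0 a0 P1 a1 P2 a2 e d1 d2"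
  shows "local_cocycles_trivial G"
  unfolding local_cocycles_trivial_def
proof (intro allI impI, elim conjE)
  fix F assume F: "finite F" "F \<subseteq> carrier G"
  have P0: "fg_projective G P0 a0" and P1: "fg_projective G P1 a1" and P2: "fg_projective G P2 a2"
    and e: "ZG_linear G P0 a0 UNIV (\<lambda>g k. k) e"
    and d1: "ZG_linear G P1 a1 P0 a0 d1" and d2: "ZG_linear G P2 a2 P1 a1 d2"
    and e_surj: "e ` P0 = UNIV" and ex0: "{x\<in>P0. e x = 0} = d1 ` P1"
    and ex1: "{x\<in>P1. d1 x = 0} = d2 ` P2"
    using assms unfolding FP2_resolution_def by blast+
  have m0: "ZG_module G P0 a0" and m1: "ZG_module G P1 a1" and m2: "ZG_module G P2 a2"
    using P0 P1 P2 by (simp_all add: fg_projective_def)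
  let ?A = "carrier G"
  let ?T0 = "\<lambda>g. frag_map (\<lambda>x. g \<otimes> x)" and ?T1 = "\<lambda>g. frag_map (\<lambda>(x, y). (g \<otimes> x, g \<otimes> y))"
  have K0: "ZG_module G (frags_on ?A) ?T0"
    by (rule permutation_module) (auto simp: m_assoc)
  have K1: "ZG_module G (frags_on (?A \<times> ?A)) ?T1"
    by (rule permutation_module) (auto simp: m_assoc)
  have aug: "ZG_linear G (frags_on ?A) ?T0 UNIV (\<lambda>g k. k) (weight (\<lambda>_. 1))"
    by (simp add: ZG_linear_def weight_frag_map)
  have onto: "e ` P0 \<subseteq> weight (\<lambda>_. 1) ` frags_on ?A"
  proof -
    have "k = weight (\<lambda>_. 1) (frag_cmul k (frag_of \<one>))" for k
      by (simp add: weight_def frag_extend_cmul)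
    moreover have "frag_cmul k (frag_of \<one>) \<in> frags_on ?A" for k
      by (simp add: frags_on_def subset_iff keys_frag_of)
    ultimately show ?thesis by blast
  qed
  obtain f0 where f0: "ZG_linear G P0 a0 (frags_on ?A) ?T0 f0"
    and f0_aug: "\<And>x. x \<in> P0 \<Longrightarrow> weight (\<lambda>_. 1) (f0 x) = e x"
    using projective_lift[OF P0 _ _ K0 aug e onto] by (auto simp: m_assoc)
  have bd: "ZG_linear G (frags_on (?A \<times> ?A)) ?T1 (frags_on ?A) ?T0 bd1"
    unfolding ZG_linear_def by (simp add: bd1_frags_on bd1_equivariant)
  have "f0 (d1 y) \<in> bd1 ` frags_on (?A \<times> ?A)" if "y \<in> P1" for y
  proof -
    have "d1 y \<in> P0" "e (d1 y) = 0" using ex0 that by blast+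
    thus ?thesis using cone0[of "f0 (d1 y)" ?A \<one>] f0 f0_aug
      by (metis ZG_linear_closed image_eqI one_closed)
  qed
  hence sub: "(\<lambda>y. f0 (d1 y)) ` P1 \<subseteq> bd1 ` frags_on (?A \<times> ?A)" by blast
  have act: "(case p of (x, y) \<Rightarrow> (g \<otimes> x, g \<otimes> y)) \<in> ?A \<times> ?A" if "g \<in> ?A" "p \<in> ?A \<times> ?A" for g p
    using that by auto
  have act': "(case p of (x, y) \<Rightarrow> (g \<otimes> h \<otimes> x, g \<otimes> h \<otimes> y))
    = (case case p of (x, y) \<Rightarrow> (h \<otimes> x, h \<otimes> y) of (x, y) \<Rightarrow> (g \<otimes> x, g \<otimes> y))"
    if "g \<in> ?A" "h \<in> ?A" "p \<in> ?A \<times> ?A" for g h p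
    using that by (auto simp: m_assoc)
  obtain f1 where f1: "ZG_linear G P1 a1 (frags_on (?A \<times> ?A)) ?T1 f1"
    and f1_bd: "\<And>y. y \<in> P1 \<Longrightarrow> bd1 (f1 y) = f0 (d1 y)"
    using projective_lift[OF P1 act act' K1 bd ZG_linear_comp[OF d1 f0] sub] by blast
  obtain x0 where x0: "x0 \<in> P0" "e x0 = 1" using e_surj by (metis UNIV_I imageE)
  have Y_ex: "\<exists>y\<in>P1. d1 y = a0 g x0 - x0" if "g \<in> ?A" for g
  proof -
    have "a0 g x0 \<in> P0" using m0 x0 that by (simp add: ZG_module_def)
    moreover have "e (a0 g x0) = 1" using e x0 that by (simp add: ZG_linear_def)
    ultimately have "a0 g x0 - x0 \<in> {x\<in>P0. e x = 0}"
      using ZG_module_diff[OF m0] ZG_linear_diff[OF m0 e] x0 by simp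
    thus ?thesis using ex0 by auto
  qed
  then obtain Y where Y: "\<And>g. g \<in> ?A \<Longrightarrow> Y g \<in> P1" "\<And>g. g \<in> ?A \<Longrightarrow> d1 (Y g) = a0 g x0 - x0"
    by metis
  have f0x: "f0 x0 \<in> frags_on ?A" using f0 x0 by (rule_tac ZG_linear_closed)
  \<comment> \<open>\<open>f0 x0\<close> has augmentation one but may differ from the single vertex
    \<open>\<one>\<close>; \<open>\<theta>\<close> joins the two.\<close>
  obtain \<theta> where \<theta>: "\<theta> \<in> frags_on (?A \<times> ?A)" "bd1 \<theta> = frag_of \<one> - f0 x0"
    using cone0[of "frag_of \<one> - f0 x0" ?A \<one>] f0x f0_aug x0 by auto
  \<comment> \<open>The edge from \<open>\<one>\<close> to \<open>k\<close> and the image of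
    \<open>Y k\<close> become homologous once their ends are joined by \<open>\<theta>\<close> and
    its translate by \<open>k\<close>. The chain \<open>\<eta>\<close> is the filling.\<close>
  have "\<exists>\<eta>\<in>frags_on (?A \<times> ?A \<times> ?A). bd2 \<eta> = frag_of (\<one>, k) - f1 (Y k) - ?T1 k \<theta> + \<theta>" if k: "k \<in> ?A" for k
  proof -
    have "?T1 k \<theta> \<in> frags_on (?A \<times> ?A)" using \<theta>(1) k by (auto intro: frag_map_on)
    moreover have "f1 (Y k) \<in> frags_on (?A \<times> ?A)" using Y k f1 by (simp add: ZG_linear_def)
    moreover have "f0 (a0 k x0 - x0) = ?T0 k (f0 x0) - f0 x0"
      using ZG_linear_diff[OF m0 f0] m0 x0 k ZG_linear_act[OF f0 k x0(1)] by (simp add: ZG_module_def)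
    hence "bd1 (frag_of (\<one>, k) - f1 (Y k) - ?T1 k \<theta> + \<theta>) = 0"
      using k by (simp add: bd1_equivariant \<theta> f1_bd Y)
    ultimately show ?thesis using cone1[of "frag_of (\<one>, k) - f1 (Y k) - ?T1 k \<theta> + \<theta>" ?A \<one>] \<theta> k by auto
  qed
  then obtain \<eta> where \<eta>: "\<And>k. k \<in> ?A \<Longrightarrow> \<eta> k \<in> frags_on (?A \<times> ?A \<times> ?A)"
    "\<And>k. k \<in> ?A \<Longrightarrow> bd2 (\<eta> k) = frag_of (\<one>, k) - f1 (Y k) - ?T1 k \<theta> + \<theta>"
    by metis
  obtain n \<iota> \<rho> where
    \<iota>: "ZG_linear G P2 a2 (frags_on ({..<n::nat} \<times> ?A)) (\<lambda>g. frag_map (\<lambda>(j, h). (j, g \<otimes> h))) \<iota>" and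
    \<rho>: "ZG_linear G (frags_on ({..<n} \<times> ?A)) (\<lambda>g. frag_map (\<lambda>(j, h). (j, g \<otimes> h))) P2 a2 \<rho>" and
    \<rho>\<iota>: "\<And>x. x \<in> P2 \<Longrightarrow> \<rho> (\<iota> x) = x"
    using fg_projective_frags_on[OF P2] by blast
  have mB: "ZG_module G (frags_on ({..<n} \<times> ?A)) (\<lambda>g. frag_map (\<lambda>(j, h). (j, g \<otimes> h)))"
    by (rule permutation_module) (auto simp: m_assoc)
  let ?b = "\<lambda>j. \<rho> (frag_of (j, \<one>))"
  have b: "?b j \<in> P2" if "j < n" for j
    using \<rho> that by (simp add: ZG_linear_def)
  have "\<exists>\<beta>\<in>frags_on (?A \<times> ?A \<times> ?A). bd2 \<beta> = f1 (d2 (?b j))" if "j < n" for j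
  proof -
    have "d2 (?b j) \<in> {x\<in>P1. d1 x = 0}" using b[OF that] ex1 by blast
    hence "f1 (d2 (?b j)) \<in> frags_on (?A \<times> ?A)" "bd1 (f1 (d2 (?b j))) = 0"
      using ZG_linear_closed[OF f1] f1_bd ZG_linear_zero[OF m0 f0] by auto
    thus ?thesis using cone1[of "f1 (d2 (?b j))" ?A \<one>] by auto
  qed
  then obtain \<beta> where \<beta>: "\<And>j. j < n \<Longrightarrow> \<beta> j \<in> frags_on (?A \<times> ?A \<times> ?A)"
    "\<And>j. j < n \<Longrightarrow> bd2 (\<beta> j) = f1 (d2 (?b j))"
    by metis
  define Z where "Z = (\<Union>k\<in>F. Poly_Mapping.keys (\<eta> k)) \<union> (\<Union>j\<in>{..<n}. Poly_Mapping.keys (\<beta> j))"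
  have Z: "finite Z" "Z \<subseteq> ?A \<times> ?A \<times> ?A"
    unfolding Z_def using F \<eta>(1) \<beta>(1) by (auto simp: frags_on_def, blast+)
  define F' where "F' = (\<lambda>(x, y, z). inv x \<otimes> y) ` Z \<union> (\<lambda>(x, y, z). inv y \<otimes> z) ` Z"
  show "\<exists>F'. finite F' \<and> F' \<subseteq> ?A \<and> (\<forall>c. local_cocycle G F' c \<longrightarrow>
        (\<exists>a. \<forall>g\<in>?A. \<forall>k\<in>F. c g (g \<otimes> k) = a (g \<otimes> k) - a g))"
  proof (intro exI[of _ F'] conjI allI impI)
    show "finite F'" "F' \<subseteq> ?A" unfolding F'_def using Z by auto
    fix c assume c: "local_cocycle G F' c"
    define C where "C = weight (\<lambda>(x, y). c x y)"
    have C_simps [simp]: "C 0 = 0" "C (frag_of (x, y)) = c x y"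
      "C (v + w) = C v + C w" "C (v - w) = C v - C w" for x y v w
      by (simp_all add: C_def)
    \<comment> \<open>Increments are unchanged by left translation, so one finite set of them
      controls all translates of the fillings. As \<open>c\<close> itself is not invariant, the
      claim is made for every \<open>g\<close>.\<close>
    have C_bd2: "C (?T1 g (bd2 \<xi>)) = 0" if "\<xi> \<in> frags_on Z" "g \<in> ?A" for \<xi> g
      using that(1)
    proof (induction rule: frags_on_induct)
      case (one p)
      obtain x y z where p: "p = (x, y, z)" by (cases p)
      have A: "x \<in> ?A" "y \<in> ?A" "z \<in> ?A" using one p Z by auto
      have "inv (g \<otimes> x) \<otimes> (g \<otimes> y) = inv x \<otimes> y" if "x \<in> ?A" "y \<in> ?A" for x y
      proof -
        have "inv (g \<otimes> x) \<otimes> (g \<otimes> y) = inv x \<otimes> (inv g \<otimes> (g \<otimes> y))"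
          using that \<open>g \<in> ?A\<close> by (simp add: inv_mult_group m_assoc)
        also have "inv g \<otimes> (g \<otimes> y) = y" using that \<open>g \<in> ?A\<close> by (simp add: m_assoc[symmetric])
        finally show ?thesis .
      qed
      moreover have "inv x \<otimes> y \<in> F'" "inv y \<otimes> z \<in> F'" using one p by (force simp: F'_def)+
      ultimately have "c (g \<otimes> x) (g \<otimes> y) + c (g \<otimes> y) (g \<otimes> z) = c (g \<otimes> x) (g \<otimes> z)"
        using c A \<open>g \<in> ?A\<close> unfolding local_cocycle_def by simp
      thus ?case by (simp add: p)
    qed auto
    have Cd2: "C (f1 (d2 x)) = 0" if "x \<in> P2" for x
    proof -
      have "C (f1 (d2 (\<rho> w))) = 0" if "w \<in> frags_on ({..<n} \<times> ?A)" for w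
        using that
      proof (induction rule: frags_on_induct)
        case zero
        show ?case
          using ZG_linear_zero[OF mB \<rho>] ZG_linear_zero[OF m2 d2] ZG_linear_zero[OF m1 f1] by simp
      next
        case (one p)
        then obtain j h where p: "p = (j, h)" "j < n" "h \<in> ?A" by auto
        have "\<rho> (frag_of p) = a2 h (?b j)"
          using ZG_linear_act[OF \<rho> p(3), of "frag_of (j, \<one>)"] p by simp
        hence "f1 (d2 (\<rho> (frag_of p))) = ?T1 h (bd2 (\<beta> j))"
          using \<beta> p b ZG_linear_act[OF d2] ZG_linear_act[OF f1] ZG_linear_closed[OF d2] by simp
        moreover have "\<beta> j \<in> frags_on Z" using p by (auto simp: Z_def frags_on_def)
        ultimately show ?case using C_bd2 p by simp
      next
        case (diff v w)
        have "\<rho> (v - w) = \<rho> v - \<rho> w" by (rule ZG_linear_diff[OF mB \<rho>]) (use diff in auto)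
        moreover have "d2 (\<rho> v - \<rho> w) = d2 (\<rho> v) - d2 (\<rho> w)"
          by (rule ZG_linear_diff[OF m2 d2]) (use diff ZG_linear_closed[OF \<rho>] in auto)
        moreover have "f1 (d2 (\<rho> v) - d2 (\<rho> w)) = f1 (d2 (\<rho> v)) - f1 (d2 (\<rho> w))"
          by (rule ZG_linear_diff[OF m1 f1])
            (use diff ZG_linear_closed[OF \<rho>] ZG_linear_closed[OF d2] in auto)
        ultimately show ?case using diff by simp
      qed
      from this[of "\<iota> x"] show ?thesis using \<rho>\<iota> that ZG_linear_closed[OF \<iota>] by simp
    qed
    \<comment> \<open>The choice of \<open>Y\<close> is not equivariant: \<open>a1 g (Y k)\<close>
      and \<open>Y (g \<otimes> k) - Y g\<close> agree only after applying \<open>d1\<close>.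
      Exactness at \<open>P1\<close> turns this into equality of integrals.\<close>
    have C_wd: "C (f1 y) = C (f1 y')" if "y \<in> P1" "y' \<in> P1" "d1 y = d1 y'" for y y'
    proof -
      have "y - y' \<in> {x\<in>P1. d1 x = 0}"
        using that ZG_module_diff[OF m1] ZG_linear_diff[OF m1 d1] by simp
      then obtain x where "x \<in> P2" "y - y' = d2 x" using ex1 by auto
      hence "C (f1 (y - y')) = 0" using Cd2 by simp
      thus ?thesis using ZG_linear_diff[OF m1 f1] that by simp
    qed
    show "\<exists>a. \<forall>g\<in>?A. \<forall>k\<in>F. c g (g \<otimes> k) = a (g \<otimes> k) - a g"
    \<comment> \<open>The integral along the image of a path from \<open>x0\<close> to its translate
      by \<open>g\<close>, corrected at the far end by the translate of
      \<open>\<theta>\<close>.\<close>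
    proof (intro exI[of _ "\<lambda>g. C (f1 (Y g)) + C (?T1 g \<theta>)"] ballI)
      fix g k assume g: "g \<in> ?A" and "k \<in> F"
      hence k: "k \<in> ?A" and gk: "g \<otimes> k \<in> ?A" using F by auto
      have aY: "a1 g (Y k) \<in> P1" using m1 Y g k by (simp add: ZG_module_def)
      have "d1 (a1 g (Y k)) = a0 g (a0 k x0 - x0)"
        using ZG_linear_act[OF d1 g] Y k by simp
      also have "\<dots> = a0 (g \<otimes> k) x0 - a0 g x0"
      proof -
        have "a0 k x0 \<in> P0" "a0 k x0 - x0 \<in> P0" using m0 x0 k ZG_module_diff[OF m0] by (simp_all add: ZG_module_def)
        hence "a0 g (a0 k x0 - x0 + x0) = a0 g (a0 k x0 - x0) + a0 g x0" "a0 (g \<otimes> k) x0 = a0 g (a0 k x0)"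
          using m0 x0 g k unfolding ZG_module_def by blast+
        thus ?thesis by simp
      qed
      also have "\<dots> = d1 (Y (g \<otimes> k) - Y g)"
        using ZG_linear_diff[OF m1 d1] Y g gk by simp
      finally have "C (f1 (a1 g (Y k))) = C (f1 (Y (g \<otimes> k) - Y g))"
        using C_wd aY ZG_module_diff[OF m1] Y g gk by blast
      hence *: "C (?T1 g (f1 (Y k))) = C (f1 (Y (g \<otimes> k))) - C (f1 (Y g))"
        using ZG_linear_diff[OF m1 f1] ZG_linear_act[OF f1 g] Y g k gk by simp
      have "\<eta> k \<in> frags_on Z" using \<open>k \<in> F\<close> by (auto simp: Z_def frags_on_def)
      from C_bd2[OF this g] have "C (?T1 g (frag_of (\<one>, k) - f1 (Y k) - ?T1 k \<theta> + \<theta>)) = 0"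
        using \<eta> k by simp
      moreover have "?T1 g (?T1 k \<theta>) = ?T1 (g \<otimes> k) \<theta>"
        using K1 \<theta>(1) g k by (simp add: ZG_module_def)
      ultimately show "c g (g \<otimes> k) = C (f1 (Y (g \<otimes> k))) + C (?T1 (g \<otimes> k) \<theta>) - (C (f1 (Y g)) + C (?T1 g \<theta>))"
        using * g by simp
    qed
  qed
qed

section \<open>Coxeter systems\<close>

fun alt_word :: "'s \<Rightarrow> 's \<Rightarrow> nat \<Rightarrow> 's list" where
  "alt_word a b 0 = []"
| "alt_word a b (Suc n) = a # alt_word b a n"

lemma alt_word_snoc: "alt_word a b (Suc n) = alt_word a b n @ [if even n then a else b]"
proof (induction n arbitrary: a b)
  case (Suc n)
  have "alt_word a b (Suc (Suc n)) = a # alt_word b a (Suc n)" by simp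
  also have "\<dots> = a # alt_word b a n @ [if even n then b else a]" by (simp only: Suc)
  finally show ?case by simp
qed simp

lemma length_alt_word [simp]: "length (alt_word a b n) = n"
  by (induction n arbitrary: a b) auto

lemma set_alt_word: "set (alt_word a b n) \<subseteq> {a, b}"
proof (induction n arbitrary: a b)
  case (Suc n)
  show ?case using Suc[of b a] by auto
qed simp

locale coxeter =
  fixes W :: "('w, 'b) monoid_scheme" (structure) and S :: "'w set"
  assumes cox: "coxeter_system W S"
begin

sublocale group W
  using cox by (simp add: coxeter_system_def)

lemma S_closed [simp]: "s \<in> S \<Longrightarrow> s \<in> carrier W"
  using cox by (auto simp: coxeter_system_def)

lemma S_square [simp]: "s \<in> S \<Longrightarrow> s \<otimes> s = \<one>"
  using cox by (simp add: coxeter_system_def)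

lemma S_not_one: "s \<in> S \<Longrightarrow> s \<noteq> \<one>"
  using cox by (auto simp: coxeter_system_def)

lemma S_inv [simp]: "s \<in> S \<Longrightarrow> inv s = s"
  by (rule inv_equality) auto

lemma S_cancel [simp]:
  assumes "s \<in> S" "w \<in> carrier W"
  shows "s \<otimes> (s \<otimes> w) = w" "w \<otimes> s \<otimes> s = w"
  using assms by (simp_all add: m_assoc[symmetric]) (simp add: m_assoc)

abbreviation len :: "'w \<Rightarrow> nat" where "len \<equiv> word_length W S"
abbreviation wp :: "'w list \<Rightarrow> 'w" where "wp \<equiv> word_prod W"

lemma wp_closed [simp]: "set ws \<subseteq> S \<Longrightarrow> wp ws \<in> carrier W"
  by (rule word_prod_closed) auto

lemma wp_append: "set u \<subseteq> S \<Longrightarrow> set v \<subseteq> S \<Longrightarrow> wp (u @ v) = wp u \<otimes> wp v"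
  by (rule word_prod_append) auto

lemma ex_word: "w \<in> carrier W \<Longrightarrow> \<exists>ws. set ws \<subseteq> S \<and> wp ws = w"
proof -
  have "carrier W = {wp ws | ws. set ws \<subseteq> S}"
    using cox unfolding coxeter_system_def by (elim conjE)
  thus "w \<in> carrier W \<Longrightarrow> \<exists>ws. set ws \<subseteq> S \<and> wp ws = w" by auto
qed

lemma len_le: "set ws \<subseteq> S \<Longrightarrow> len (wp ws) \<le> length ws"
  unfolding word_length_def by (rule Least_le) auto

lemma ex_reduced_word:
  assumes "w \<in> carrier W"
  obtains ws where "set ws \<subseteq> S" "wp ws = w" "length ws = len w"
  using LeastI_ex[of "\<lambda>n. \<exists>ws. length ws = n \<and> set ws \<subseteq> S \<and> wp ws = w"] ex_word[OF assms]
  unfolding word_length_def by blast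

lemma len_mult:
  assumes "v \<in> carrier W" "w \<in> carrier W"
  shows "len (v \<otimes> w) \<le> len v + len w"
proof -
  obtain a b where "set a \<subseteq> S" "wp a = v" "length a = len v" "set b \<subseteq> S" "wp b = w" "length b = len w"
    using ex_reduced_word[OF assms(1)] ex_reduced_word[OF assms(2)] by metis
  thus ?thesis using len_le[of "a @ b"] by (simp add: wp_append)
qed

lemma len_one [simp]: "len \<one> = 0"
  using len_le[of "[]"] by simp

lemma len_eq_0: "w \<in> carrier W \<Longrightarrow> len w = 0 \<longleftrightarrow> w = \<one>"
  by (metis ex_reduced_word len_one length_0_conv word_prod_Nil)

lemma len_S [simp]: "s \<in> S \<Longrightarrow> len s = 1"
  using len_le[of "[s]"] len_eq_0[of s] S_not_one[of s] by simp

lemma len_inv_le: "w \<in> carrier W \<Longrightarrow> len (inv w) \<le> len w"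
proof -
  assume "w \<in> carrier W"
  then obtain ws where ws: "set ws \<subseteq> S" "wp ws = w" "length ws = len w" by (rule ex_reduced_word)
  hence "wp (rev ws) = inv w" using word_prod_rev[of ws] by (auto simp: subset_iff)
  thus ?thesis using len_le[of "rev ws"] ws by simp
qed

lemma len_inv [simp]: "w \<in> carrier W \<Longrightarrow> len (inv w) = len w"
  using len_inv_le[of w] len_inv_le[of "inv w"] by simp

lemma dihedral_pow_comm:
  assumes "a \<in> S" "b \<in> S"
  shows "a \<otimes> (b \<otimes> (a \<otimes> b) [^] (i::nat)) = (a \<otimes> b) [^] i \<otimes> (a \<otimes> b)"
  using nat_pow_Suc2[of "a \<otimes> b" i] assms by (simp add: m_assoc)

lemma path_sum_relator:
  fixes \<kappa> :: "'w \<Rightarrow> 'w \<Rightarrow> 'v::ab_group_add"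
  assumes "a \<in> S" "b \<in> S" "g \<in> carrier W"
  shows "path_sum W (\<lambda>s. s) \<kappa> g (concat (replicate m [a, b]))
    = (\<Sum>i<m. \<kappa> (g \<otimes> (a \<otimes> b) [^] i) a + \<kappa> (g \<otimes> (a \<otimes> b) [^] i \<otimes> a) b)"
  using assms(3)
proof (induction m arbitrary: g)
  case (Suc m)
  have *: "g \<otimes> a \<otimes> b \<otimes> (a \<otimes> b) [^] i = g \<otimes> (a \<otimes> b) [^] (Suc i)" for i :: nat
    using Suc.prems assms by (simp add: m_assoc dihedral_pow_comm)
  show ?case using Suc.IH[of "g \<otimes> a \<otimes> b"] Suc.prems assms
    by (subst sum.lessThan_Suc_shift) (simp add: add.assoc * del: nat_pow_Suc)
qed simp

text \<open>This is how functions on \<open>W\<close> are built from labels that cancel along the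
  relators; it yields the parity of the length, the parity of wall crossings and the sides of
  \<open>H\<close>. The case \<open>a = b\<close> is left out of \<open>br\<close> because there the
  order is one and the relator is \<open>[a, a]\<close>, already covered by
  \<open>sq\<close>.\<close>

lemma cox_path_sum:
  fixes \<kappa> :: "'w \<Rightarrow> 'w \<Rightarrow> 'v::ab_group_add"
  assumes sq: "\<And>g s. g \<in> carrier W \<Longrightarrow> s \<in> S \<Longrightarrow> \<kappa> g s + \<kappa> (g \<otimes> s) s = 0"
    and br: "\<And>g a b. g \<in> carrier W \<Longrightarrow> a \<in> S \<Longrightarrow> b \<in> S \<Longrightarrow> a \<noteq> b \<Longrightarrow> cox_m W a b \<noteq> 0 \<Longrightarrow>
        (\<Sum>i<cox_m W a b. \<kappa> (g \<otimes> (a \<otimes> b) [^] i) a + \<kappa> (g \<otimes> (a \<otimes> b) [^] i \<otimes> a) b) = 0"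
    and uv: "set u \<subseteq> S" "set v \<subseteq> S" "wp u = wp v" and g: "g \<in> carrier W"
  shows "path_sum W (\<lambda>s. s) \<kappa> g u = path_sum W (\<lambda>s. s) \<kappa> g v"
proof -
  have rel: "set r \<subseteq> S \<and> word_prod W (map (\<lambda>s. s) r) = \<one> \<and>
    (\<forall>g\<in>carrier W. path_sum W (\<lambda>s. s) \<kappa> g r = 0)" if "r \<in> coxeter_relators W S" for r
  proof -
  have "(\<exists>s\<in>S. r = [s, s]) \<or> (\<exists>a\<in>S. \<exists>b\<in>S. cox_m W a b \<noteq> 0 \<and> r = concat (replicate (cox_m W a b) [a, b]))"
    using that unfolding coxeter_relators_def by blast
  then consider s where "s \<in> S" "r = [s, s]" |
    a b where "a \<in> S" "b \<in> S" "cox_m W a b \<noteq> 0" "r = concat (replicate (cox_m W a b) [a, b])"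
    by blast
  thus "set r \<subseteq> S \<and> word_prod W (map (\<lambda>s. s) r) = \<one> \<and>
    (\<forall>g\<in>carrier W. path_sum W (\<lambda>s. s) \<kappa> g r = 0)"
  proof cases
    case 1
    thus ?thesis using sq by simp
  next
    case 2
    have "wp (concat (replicate m [a, b])) = (a \<otimes> b) [^] m" for m :: nat
      using 2 by (induction m) (simp_all add: dihedral_pow_comm)
    hence "wp r = \<one>" using 2 by (simp add: cox_m_def pow_ord_eq_1)
    moreover have "set r \<subseteq> S" using 2 by auto
    moreover have "path_sum W (\<lambda>s. s) \<kappa> g r = 0" if g: "g \<in> carrier W" for g
    proof (cases "a = b")
      case True
      hence "cox_m W a b = 1" using 2 by (simp add: cox_m_def ord_id)
      thus ?thesis using 2 True sq[OF g, of a] by simp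
    next
      case False
      thus ?thesis using 2 br[OF g] by (simp only: path_sum_relator[OF 2(1,2) g])
    qed
    ultimately show ?thesis by simp
  qed
  qed
  show ?thesis
  proof (rule path_sum_determined[OF _ rel _ _ uv(1,2) _ g])
    show "(\<lambda>s. s) ` S \<subseteq> carrier W" by auto
    show "carrier W \<subseteq> {word_prod W (map (\<lambda>s. s) w) |w. set w \<subseteq> S}"
      using ex_word by (simp add: subset_iff) metis
    show "word_prod W (map (\<lambda>s. s) u) = word_prod W (map (\<lambda>s. s) v)" using uv by simp
    show "word_cong (coxeter_relators W S) w []"
      if "set w \<subseteq> S" "word_prod W (map (\<lambda>s. s) w) = \<one>" for w
      using that cox by (simp add: coxeter_system_def)
  qed
qed

lemma sum_lessThan_add:
  fixes f :: "nat \<Rightarrow> 'v::ab_group_add"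
  shows "(\<Sum>j<n + k. f j) = (\<Sum>j<n. f j) + (\<Sum>j<k. f (n + j))"
  by (induction k) (simp_all add: add.assoc)

lemma add_self_bit: "x + x = (0 :: bit)"
  by (cases x) simp_all

text \<open>Give every edge the label one modulo two: all Coxeter relators have even length.\<close>

lemma length_parity:
  assumes "set u \<subseteq> S" "set v \<subseteq> S" "wp u = wp v"
  shows "even (length u) \<longleftrightarrow> even (length v)"
proof -
  have *: "path_sum W (\<lambda>s. s) (\<lambda>_ _. 1 :: bit) g w = of_nat (length w)" for g w
    by (induction w arbitrary: g) auto
  have "path_sum W (\<lambda>s. s) (\<lambda>_ _. 1 :: bit) \<one> u = path_sum W (\<lambda>s. s) (\<lambda>_ _. 1 :: bit) \<one> v"
    by (rule cox_path_sum) (use assms in simp_all)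
  moreover have "(of_nat n = (0 :: bit)) = even n" for n by (induction n) auto
  ultimately show ?thesis unfolding * by metis
qed

lemma len_mult_S_cases:
  assumes "s \<in> S" "w \<in> carrier W"
  shows "len (s \<otimes> w) = len w + 1 \<or> len w = len (s \<otimes> w) + 1"
proof -
  have sw: "s \<otimes> w \<in> carrier W" using assms by simp
  obtain a b where a: "set a \<subseteq> S" "wp a = w" "length a = len w"
    and b: "set b \<subseteq> S" "wp b = s \<otimes> w" "length b = len (s \<otimes> w)"
    using ex_reduced_word[OF assms(2)] ex_reduced_word[OF sw] by metis
  have "even (length (s # a)) \<longleftrightarrow> even (length b)"
    by (rule length_parity) (use a b assms in auto)
  moreover have "len (s \<otimes> w) \<le> 1 + len w" using len_mult[of s w] assms by simp
  moreover have "len w \<le> 1 + len (s \<otimes> w)" using len_mult[of s "s \<otimes> w"] assms by simp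
  ultimately show ?thesis using a b by (auto simp: le_Suc_eq)
qed

text \<open>The reflections whose walls are crossed by the gallery of type \<open>w\<close> starting
  at \<open>g\<close>.\<close>

fun refls :: "'w \<Rightarrow> 'w list \<Rightarrow> 'w list" where
  "refls g [] = []"
| "refls g (s # w) = (g \<otimes> s \<otimes> inv g) # refls (g \<otimes> s) w"

lemma length_refls [simp]: "length (refls g w) = length w"
  by (induction w arbitrary: g) auto

lemma dihedral_shift:
  assumes "a \<in> S" "b \<in> S"
  shows "a \<otimes> (b \<otimes> a) [^] (i::nat) = (a \<otimes> b) [^] i \<otimes> a"
proof (induction i)
  case (Suc i)
  have "a \<otimes> (b \<otimes> a) [^] Suc i = a \<otimes> (b \<otimes> a) [^] i \<otimes> (b \<otimes> a)"
    using assms by (simp add: m_assoc)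
  also have "\<dots> = (a \<otimes> b) [^] Suc i \<otimes> a" using assms Suc by (simp add: m_assoc)
  finally show ?case .
qed (use assms in simp)

lemma refls_alt_word:
  assumes "a \<in> S" "b \<in> S" "g \<in> carrier W"
  shows "refls g (alt_word a b n) = map (\<lambda>i. g \<otimes> (a \<otimes> b) [^] i \<otimes> a \<otimes> inv g) [0..<n]"
  using assms
proof (induction n arbitrary: a b g)
  case (Suc n)
  have "g \<otimes> a \<otimes> (b \<otimes> a) [^] i \<otimes> b \<otimes> inv (g \<otimes> a) = g \<otimes> (a \<otimes> b) [^] Suc i \<otimes> a \<otimes> inv g" for i :: nat
  proof -
    have "g \<otimes> a \<otimes> (b \<otimes> a) [^] i \<otimes> b \<otimes> inv (g \<otimes> a) = g \<otimes> (a \<otimes> (b \<otimes> a) [^] i) \<otimes> b \<otimes> a \<otimes> inv g"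
      using Suc.prems by (simp add: m_assoc inv_mult_group)
    thus ?thesis using Suc.prems by (simp add: dihedral_shift m_assoc)
  qed
  thus ?case using Suc by (simp add: upt_conv_Cons map_Suc_upt[symmetric] del: upt_Suc nat_pow_Suc)
qed simp

lemma path_sum_refls:
  "path_sum W (\<lambda>s. s) (\<lambda>g s. if g \<otimes> s \<otimes> inv g = T then 1 else (0::bit)) g w
    = (\<Sum>r\<leftarrow>refls g w. if r = T then 1 else 0)"
  by (induction w arbitrary: g) auto

text \<open>The number of crossings of the wall of \<open>T\<close> is determined modulo two by the
  end point. Along a braid relator of length \<open>2 * m\<close> the sequence of reflections has
  period \<open>m\<close>, so every wall is crossed an even number of times.\<close>

lemma refl_path_sum_eq:
  assumes "set u \<subseteq> S" "set v \<subseteq> S" "wp u = wp v"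
  shows "(\<Sum>r\<leftarrow>refls \<one> u. if r = T then 1 else (0::bit)) = (\<Sum>r\<leftarrow>refls \<one> v. if r = T then 1 else 0)"
  unfolding path_sum_refls[symmetric]
proof (rule cox_path_sum[OF _ _ assms])
  fix g s assume "g \<in> carrier W" "s \<in> S"
  hence "g \<otimes> s \<otimes> s \<otimes> inv (g \<otimes> s) = g \<otimes> s \<otimes> inv g"
    by (simp add: inv_mult_group m_assoc)
  thus "(if g \<otimes> s \<otimes> inv g = T then 1 else 0) +
           (if g \<otimes> s \<otimes> s \<otimes> inv (g \<otimes> s) = T then 1 else (0::bit)) = 0" by simp
next
  fix g a b assume g: "g \<in> carrier W" and ab: "a \<in> S" "b \<in> S" and m: "cox_m W a b \<noteq> 0"
  let ?m = "cox_m W a b" and ?x = "a \<otimes> b"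
  let ?f = "\<lambda>j::nat. if g \<otimes> ?x [^] j \<otimes> a \<otimes> inv g = T then 1 else (0::bit)"
  have xa: "a \<otimes> inv (?x [^] i) = ?x [^] i \<otimes> a" for i :: nat
  proof -
    have "inv (?x [^] i) = (b \<otimes> a) [^] i"
      using ab by (simp add: nat_pow_inv[symmetric] inv_mult_group)
    thus ?thesis using dihedral_shift ab by simp
  qed
  \<comment> \<open>\<open>A\<close> treats the even positions of the relator and \<open>B\<close>
    the odd ones. Both give the same formula in the position \<open>j\<close>, so the two families
    merge into one sum over \<open>j < 2 * m\<close>.\<close>
  have A: "g \<otimes> ?x [^] i \<otimes> a \<otimes> inv (g \<otimes> ?x [^] i) = g \<otimes> ?x [^] (2 * i) \<otimes> a \<otimes> inv g" for i :: nat
  proof -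
    have "g \<otimes> ?x [^] i \<otimes> a \<otimes> inv (g \<otimes> ?x [^] i) = g \<otimes> ?x [^] i \<otimes> (a \<otimes> inv (?x [^] i)) \<otimes> inv g"
      using g ab by (simp add: inv_mult_group m_assoc)
    also have "\<dots> = g \<otimes> (?x [^] i \<otimes> ?x [^] i) \<otimes> a \<otimes> inv g"
      unfolding xa using g ab by (simp add: m_assoc)
    finally show ?thesis using ab by (simp add: nat_pow_mult mult_2)
  qed
  have B: "g \<otimes> ?x [^] i \<otimes> a \<otimes> b \<otimes> inv (g \<otimes> ?x [^] i \<otimes> a) = g \<otimes> ?x [^] (2 * i + 1) \<otimes> a \<otimes> inv g" for i :: nat
  proof -
    have "g \<otimes> ?x [^] i \<otimes> a \<otimes> b \<otimes> inv (g \<otimes> ?x [^] i \<otimes> a)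
      = g \<otimes> ?x [^] i \<otimes> ?x \<otimes> (a \<otimes> inv (?x [^] i)) \<otimes> inv g"
      using g ab by (simp add: inv_mult_group m_assoc)
    also have "\<dots> = g \<otimes> (?x [^] i \<otimes> ?x \<otimes> ?x [^] i) \<otimes> a \<otimes> inv g"
      unfolding xa using g ab by (simp add: m_assoc)
    also have "?x [^] i \<otimes> ?x \<otimes> ?x [^] i = ?x [^] (2 * i + 1)"
      using ab nat_pow_mult[of ?x "Suc i" i] by (simp add: mult_2)
    finally show ?thesis .
  qed
  have "(\<Sum>i<n. ?f (2 * i) + ?f (2 * i + 1)) = (\<Sum>j<2 * n. ?f j)" for n
    by (induction n) (simp_all add: add.assoc del: nat_pow_Suc)
  moreover note sum_lessThan_add[of ?f ?m ?m]
  moreover have "?x [^] (?m + j) = ?x [^] j" for j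
    using ab by (simp add: nat_pow_mult[symmetric] cox_m_def pow_ord_eq_1)
  ultimately have "(\<Sum>i<?m. ?f (2 * i) + ?f (2 * i + 1)) = (\<Sum>j<?m. ?f j) + (\<Sum>j<?m. ?f j)"
    by (simp only: mult_2)
  also have "\<dots> = 0" by (rule add_self_bit)
  finally show "(\<Sum>i<?m. (if g \<otimes> ?x [^] i \<otimes> a \<otimes> inv (g \<otimes> ?x [^] i) = T then 1 else 0) +
      (if g \<otimes> ?x [^] i \<otimes> a \<otimes> b \<otimes> inv (g \<otimes> ?x [^] i \<otimes> a) = T then 1 else (0::bit))) = 0"
    unfolding A B .
qed simp

lemma indicator_sum_list:
  "x \<notin> set xs \<Longrightarrow> (\<Sum>y\<leftarrow>xs. if y = x then 1 else (0::bit)) = 0"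
  "distinct xs \<Longrightarrow> x \<in> set xs \<Longrightarrow> (\<Sum>y\<leftarrow>xs. if y = x then 1 else (0::bit)) = 1"
proof -
  show *: "(\<Sum>y\<leftarrow>xs. if y = x then 1 else (0::bit)) = 0" if "x \<notin> set xs" for xs
    using that by (induction xs) auto
  show "distinct xs \<Longrightarrow> x \<in> set xs \<Longrightarrow> (\<Sum>y\<leftarrow>xs. if y = x then 1 else (0::bit)) = 1"
    by (induction xs) (auto simp: *)
qed

text \<open>A wall crossed exactly once is crossed an odd number of times by every word with the
  same product. So a shortest such word crosses all these walls and cannot be shorter than
  \<open>u\<close>.\<close>

lemma distinct_refls_reduced:
  assumes "set u \<subseteq> S" "distinct (refls \<one> u)"
  shows "len (wp u) = length u"
proof -
  obtain v where v: "set v \<subseteq> S" "wp v = wp u" "length v = len (wp u)"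
    using ex_reduced_word[of "wp u"] assms by auto
  have "T \<in> set (refls \<one> v)" if "T \<in> set (refls \<one> u)" for T
  proof (rule ccontr)
    assume "T \<notin> set (refls \<one> v)"
    hence "(\<Sum>r\<leftarrow>refls \<one> v. if r = T then 1 else (0::bit)) = 0"
      by (rule indicator_sum_list)
    moreover have "(\<Sum>r\<leftarrow>refls \<one> u. if r = T then 1 else (0::bit)) = 1"
      using assms(2) that by (rule indicator_sum_list)
    ultimately show False using refl_path_sum_eq[OF assms(1) v(1) v(2)[symmetric]] by simp
  qed
  hence "card (set (refls \<one> u)) \<le> card (set (refls \<one> v))" by (intro card_mono) auto
  also have "\<dots> \<le> length v" using card_length[of "refls \<one> v"] by simp
  finally have "length u \<le> len (wp u)" using assms(2) v by (simp add: distinct_card)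
  thus ?thesis using len_le[OF assms(1)] by simp
qed

text \<open>Infinite order makes the powers of \<open>a \<otimes> b\<close> distinct, and with them
  the reflections met along the word.\<close>

lemma len_alt_word:
  assumes "a \<in> S" "b \<in> S" "cox_m W a b = 0"
  shows "len (wp (alt_word a b n)) = n"
proof -
  have "inj_on (\<lambda>i::nat. (a \<otimes> b) [^] i) UNIV"
  proof (rule inj_onI)
    fix i j :: nat
    have *: "i = j" if "(a \<otimes> b) [^] i = (a \<otimes> b) [^] j" "i \<le> j" for i j :: nat
    proof -
      have "(a \<otimes> b) [^] (j - i) = \<one>" using that assms pow_eq_div2[of "a \<otimes> b" j i] by simp
      hence "0 dvd j - i" using pow_eq_id[of "a \<otimes> b" "j - i"] assms by (simp add: cox_m_def)
      thus ?thesis using that by simp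
    qed
    assume "(a \<otimes> b) [^] i = (a \<otimes> b) [^] j"
    thus "i = j" using *[of i j] *[of j i] by (cases "i \<le> j") auto
  qed
  hence "distinct (map (\<lambda>i. \<one> \<otimes> (a \<otimes> b) [^] i \<otimes> a \<otimes> inv \<one>) [0..<n])"
    using assms by (auto simp: distinct_map inj_on_def)
  hence "distinct (refls \<one> (alt_word a b n))"
    using assms by (simp add: refls_alt_word)
  moreover have "set (alt_word a b n) \<subseteq> S" using set_alt_word[of a b n] assms by auto
  ultimately show ?thesis using distinct_refls_reduced[of "alt_word a b n"] by simp
qed

end

section \<open>The two sides of the Coxeter group\<close>

context coxeter
begin

lemma cox_m_commute:
  assumes "a \<in> S" "b \<in> S"
  shows "cox_m W a b = cox_m W b a"
proof -
  have "b \<otimes> a = inv (a \<otimes> b)" using assms by (simp add: inv_mult_group)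
  thus ?thesis using assms by (simp add: cox_m_def ord_inv)
qed

text \<open>Right multiplication by \<open>x\<close> shifts the points
  \<open>h \<otimes> x [^] i\<close> cyclically, so \<open>e\<close> and
  \<open>e \<otimes> x\<close> are met equally often. For infinite order, encoded as
  \<open>ord x = 0\<close>, both sums are empty.\<close>

lemma sum_cyclic_shift:
  assumes "x \<in> carrier W" "h \<in> carrier W" "e \<in> carrier W"
  shows "(\<Sum>i<ord x. if h \<otimes> x [^] i = e \<otimes> x then 1 else (0::bit))
    = (\<Sum>i<ord x. if h \<otimes> x [^] i = e then 1 else 0)"
proof -
  let ?f = "\<lambda>i::nat. if h \<otimes> x [^] i = e \<otimes> x then 1 else (0::bit)"
  have "?f (Suc i) = (if h \<otimes> x [^] i = e then 1 else 0)" for i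
    using assms by (simp add: m_assoc[symmetric])
  hence "(\<Sum>i<ord x. if h \<otimes> x [^] i = e then 1 else 0) = (\<Sum>i<ord x. ?f (Suc i))"
    by (simp del: nat_pow_Suc)
  also have "\<dots> = (\<Sum>i<Suc (ord x). ?f i) - ?f 0"
    by (subst sum.lessThan_Suc_shift) (simp only: add_diff_cancel_left')
  also have "\<dots> = (\<Sum>i<ord x. ?f i) + ?f (ord x) - ?f 0"
    by (simp only: sum.lessThan_Suc)
  also have "?f (ord x) = ?f 0" using assms by (simp add: pow_ord_eq_1)
  finally show ?thesis by (simp only: add_diff_cancel_right')
qed

text \<open>Since the order of \<open>s t\<close> is infinite, \<open>W\<close> is the amalgam of \<open>\<langle>s, u\<rangle>\<close> and
  \<open>\<langle>t, u\<rangle>\<close> over \<open>\<langle>u\<rangle>\<close>. The set \<open>H\<close> is the half of the Bass--Serre tree on the \<open>t\<close>-side of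
  the edge \<open>\<langle>u\<rangle>\<close>; membership is the parity of the number of \<open>t\<close>-steps taken from or to \<open>\<langle>u\<rangle>\<close>.\<close>

lemma separating_set:
  assumes S: "S = {s, t, u}" and ne: "s \<noteq> t" "s \<noteq> u" "t \<noteq> u" and inf: "cox_m W s t = 0"
  obtains H where
    "\<And>n. wp (alt_word s t n) \<notin> H" "\<And>n. n > 0 \<Longrightarrow> wp (alt_word t s n) \<in> H"
    "\<And>w r. w \<in> carrier W \<Longrightarrow> r \<in> S \<Longrightarrow> w \<in> H \<longleftrightarrow> w \<otimes> r \<notin> H \<Longrightarrow> len w \<le> 2"
proof -
  have stu: "s \<in> S" "t \<in> S" "u \<in> S" using S by auto
  define \<delta> where "\<delta> a g = (if g = a then 1 else (0::bit))" for a g :: 'w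
  \<comment> \<open>These are the ends of the two \<open>t\<close>-edges that leave
    \<open>{\<one>, u}\<close>, one joining \<open>\<one>\<close> to \<open>t\<close> and the other
    joining \<open>u\<close> to \<open>u \<otimes> t\<close>. Walking along either of them, in
    either direction, changes the side.\<close>
  define \<epsilon> where "\<epsilon> g = \<delta> \<one> g + \<delta> u g + \<delta> t g + \<delta> (u \<otimes> t) g" for g
  define \<kappa> where "\<kappa> g r = (if r = t then \<epsilon> g else 0)" for g r
  have rearrange: "(p + q + r + z) + (r + z + p + q) = 0" "(z + r + r + z) = 0" for p q r z :: bit
    by (cases p; cases q; cases r; cases z; simp)+
  have inf': "cox_m W t s = 0" using inf cox_m_commute stu by simp
  have sq: "\<kappa> g r + \<kappa> (g \<otimes> r) r = 0" if "g \<in> carrier W" "r \<in> S" for g r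
  proof (cases "r = t")
    case True
    have eq: "g \<otimes> t = a \<otimes> t \<longleftrightarrow> g = a" if "a \<in> carrier W" for a
      using that \<open>g \<in> carrier W\<close> stu by simp
    have "\<delta> \<one> (g \<otimes> t) = \<delta> t g" "\<delta> u (g \<otimes> t) = \<delta> (u \<otimes> t) g"
      "\<delta> t (g \<otimes> t) = \<delta> \<one> g" "\<delta> (u \<otimes> t) (g \<otimes> t) = \<delta> u g"
      using eq[of t] eq[of "u \<otimes> t"] eq[of \<one>] eq[of u] stu by (simp_all add: \<delta>_def)
    thus ?thesis by (simp only: \<kappa>_def \<epsilon>_def True rearrange refl if_True)
  qed (simp add: \<kappa>_def)
  \<comment> \<open>On a closed walk around a coset of the group generated by \<open>t\<close> and
    \<open>u\<close>, \<open>t\<close>-steps starting at \<open>\<one>\<close> are as frequent as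
    those starting at \<open>u \<otimes> t\<close>, and those at \<open>u\<close> as frequent as
    those at \<open>t\<close>. The total is even.\<close>
  have tu: "(\<Sum>i<cox_m W t u. \<epsilon> (h \<otimes> (t \<otimes> u) [^] i)) = 0" if "h \<in> carrier W" for h
  proof -
    let ?x = "t \<otimes> u"
    have x1: "u \<otimes> t \<otimes> ?x = \<one>" "t \<otimes> ?x = u"
      using stu by (simp_all add: m_assoc)
    have "(\<Sum>i<ord ?x. \<delta> \<one> (h \<otimes> ?x [^] i)) = (\<Sum>i<ord ?x. \<delta> (u \<otimes> t) (h \<otimes> ?x [^] i))"
      using sum_cyclic_shift[of ?x h "u \<otimes> t"] that stu unfolding x1 by (simp add: \<delta>_def)
    moreover have "(\<Sum>i<ord ?x. \<delta> u (h \<otimes> ?x [^] i)) = (\<Sum>i<ord ?x. \<delta> t (h \<otimes> ?x [^] i))"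
      using sum_cyclic_shift[of ?x h t] that stu unfolding x1 by (simp add: \<delta>_def)
    ultimately show ?thesis
      by (simp only: \<epsilon>_def sum.distrib cox_m_def rearrange)
  qed
  have \<kappa>t: "\<kappa> g t = \<epsilon> g" and \<kappa>u: "\<kappa> g u = 0" for g using ne by (simp_all add: \<kappa>_def)
  have br: "(\<Sum>i<cox_m W a b. \<kappa> (g \<otimes> (a \<otimes> b) [^] i) a + \<kappa> (g \<otimes> (a \<otimes> b) [^] i \<otimes> a) b) = 0"
    if g: "g \<in> carrier W" and "a \<in> S" "b \<in> S" "a \<noteq> b" "cox_m W a b \<noteq> 0" for g a b
  proof -
    \<comment> \<open>Here the infinite order of \<open>s \<otimes> t\<close> enters: no braid
      relator involves both \<open>s\<close> and \<open>t\<close>, so one that contains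
      \<open>t\<close> has \<open>u\<close> as its other letter.\<close>
    have "a \<noteq> t \<and> b \<noteq> t \<or> a = t \<and> b = u \<or> a = u \<and> b = t"
    proof -
      have "a \<in> {s, t, u}" "b \<in> {s, t, u}" using that S by simp_all
      moreover have "\<not> (a = s \<and> b = t)" "\<not> (a = t \<and> b = s)" using that inf inf' by auto
      ultimately show ?thesis using \<open>a \<noteq> b\<close> by auto
    qed
    then consider "a \<noteq> t" "b \<noteq> t" | "a = t" "b = u" | "a = u" "b = t"
      by blast
    thus ?thesis
    proof cases
      case 1
      thus ?thesis by (simp add: \<kappa>_def)
    next
      case 2
      thus ?thesis by (simp only: \<kappa>t \<kappa>u add_0_right tu[OF g])
    next
      case 3
      have "g \<otimes> (u \<otimes> t) [^] i \<otimes> u = g \<otimes> u \<otimes> (t \<otimes> u) [^] i" for i :: nat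
        using g stu by (simp add: m_assoc dihedral_shift)
      moreover have "g \<otimes> u \<in> carrier W" using g stu by simp
      ultimately show ?thesis
        unfolding 3 cox_m_commute[OF stu(3,2)] by (simp only: \<kappa>t \<kappa>u add_0_left tu)
    qed
  qed
  define side where "side w = path_sum W (\<lambda>s. s) \<kappa> \<one> (SOME ws. set ws \<subseteq> S \<and> wp ws = w)" for w
  have side: "side (wp ws) = path_sum W (\<lambda>s. s) \<kappa> \<one> ws" if "set ws \<subseteq> S" for ws
  proof -
    have "set (SOME vs. set vs \<subseteq> S \<and> wp vs = wp ws) \<subseteq> S \<and> wp (SOME vs. set vs \<subseteq> S \<and> wp vs = wp ws) = wp ws"
      by (rule someI[of _ ws]) (use that in simp)
    thus ?thesis unfolding side_def using cox_path_sum[of \<kappa>, OF sq br] that by blast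
  qed
  have step: "side (w \<otimes> r) = side w + \<kappa> w r" if "w \<in> carrier W" "r \<in> S" for w r
  proof -
    obtain ws where ws: "set ws \<subseteq> S" "wp ws = w" using ex_word[OF \<open>w \<in> carrier W\<close>] by blast
    have "(\<lambda>s. s) ` set ws \<subseteq> carrier W" using ws by auto
    hence "path_sum W (\<lambda>s. s) \<kappa> \<one> (ws @ [r]) = path_sum W (\<lambda>s. s) \<kappa> \<one> ws + \<kappa> w r"
      using that path_sum_append[of "\<lambda>s. s" ws \<one> "[r]" \<kappa>] ws by simp
    moreover have "wp (ws @ [r]) = w \<otimes> r" using ws that by (simp add: wp_append)
    ultimately show ?thesis using side[of "ws @ [r]"] side[of ws] ws that by simp
  qed
  have near: "len g \<le> 2 \<and> len (g \<otimes> t) \<le> 2" if "\<epsilon> g \<noteq> 0" for g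
  proof -
    have "g \<in> {\<one>, u, t, u \<otimes> t}" using that by (auto simp: \<epsilon>_def \<delta>_def split: if_splits)
    moreover have "len (u \<otimes> t) \<le> 2" using len_mult[of u t] stu by simp
    ultimately show ?thesis using stu by auto
  qed
  have far: "\<epsilon> g = 0" if "2 < len (g \<otimes> t)" for g
    by (rule ccontr) (use near[of g] that in linarith)
  have alt_step: "wp (alt_word a b (Suc n)) = wp (alt_word a b n) \<otimes> (if even n then a else b)"
    if "a \<in> S" "b \<in> S" for a b n
  proof -
    have "set (alt_word a b n) \<subseteq> S" using set_alt_word[of a b n] that by auto
    thus ?thesis unfolding alt_word_snoc using that by (subst wp_append) auto
  qed
  have alt_cl: "wp (alt_word a b n) \<in> carrier W" if "a \<in> S" "b \<in> S" for a b n
    using set_alt_word[of a b n] that by (intro wp_closed) auto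
  have side1: "side \<one> = 0" using side[of "[]"] by simp
  have "side (wp (alt_word t s n)) = 1" if "n > 0" for n
    using that
  proof (induction n rule: nat_induct_non_zero)
    case 1
    have "\<epsilon> \<one> = 1"
    proof -
      have "u \<otimes> t \<noteq> \<one>" using inv_equality[of u t] stu ne by auto
      thus ?thesis using stu S_not_one by (auto simp: \<epsilon>_def \<delta>_def)
    qed
    thus ?case using step[of \<one> t] side1 stu by (simp add: \<kappa>_def)
  next
    case (Suc n)
    have "\<kappa> (wp (alt_word t s n)) (if even n then t else s) = 0"
    proof (cases "even n")
      case True
      hence "wp (alt_word t s n) \<otimes> t = wp (alt_word t s (Suc n))"
        using alt_step[of t s n] stu by simp
      hence "len (wp (alt_word t s n) \<otimes> t) = Suc n" by (simp only: len_alt_word[OF stu(2,1) inf'])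
      moreover have "n \<ge> 2" using True \<open>n > 0\<close> by presburger
      ultimately show ?thesis using far[of "wp (alt_word t s n)"] by (simp add: \<kappa>_def)
    qed (use ne in \<open>simp add: \<kappa>_def\<close>)
    thus ?case using Suc step[OF alt_cl[of t s n], of "if even n then t else s"] stu
      by (simp only: alt_step[of t s n]) simp
  qed
  moreover have "side (wp (alt_word s t n)) = 0" for n
  proof (induction n)
    case (Suc n)
    have "\<kappa> (wp (alt_word s t n)) (if even n then s else t) = 0"
    proof (cases "even n")
      case False
      hence *: "wp (alt_word s t n) \<otimes> t = wp (alt_word s t (Suc n))"
        using alt_step[of s t n] stu by simp
      hence l: "len (wp (alt_word s t n) \<otimes> t) = Suc n" by (simp only: len_alt_word[OF stu(1,2) inf])
      show ?thesis
      \<comment> \<open>The bound \<open>far\<close> says nothing about the step from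
        \<open>s\<close> to \<open>s \<otimes> t\<close>, which ends at length two, so
        \<open>s\<close> is compared with the four ends directly.\<close>
      proof (cases "n = 1")
        case True
        have "s \<noteq> u \<otimes> t"
        proof
          assume "s = u \<otimes> t"
          hence "s \<otimes> t = u" using stu by simp
          thus False using l True stu by simp
        qed
        thus ?thesis using True ne stu S_not_one by (auto simp: \<kappa>_def \<epsilon>_def \<delta>_def)
      next
        case False
        hence "n \<ge> 2" using \<open>odd n\<close> by presburger
        thus ?thesis using far[of "wp (alt_word s t n)"] l by (simp add: \<kappa>_def)
      qed
    qed (use ne in \<open>simp add: \<kappa>_def\<close>)
    thus ?case using Suc step[OF alt_cl[of s t n], of "if even n then s else t"] stu
      by (simp only: alt_step[of s t n]) simp
  qed (use side1 in simp)
  moreover have "len w \<le> 2" if "w \<in> carrier W" "r \<in> S" "side w = 1 \<longleftrightarrow> side (w \<otimes> r) \<noteq> 1" for w r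
  proof -
    have "\<kappa> w r \<noteq> 0" using step[OF that(1,2)] that(3) by auto
    thus ?thesis using near[of w] by (auto simp: \<kappa>_def split: if_splits)
  qed
  ultimately show thesis using that[of "{w. side w = 1}"] by simp
qed

end

section \<open>Buildings\<close>

locale chamber_system = coxeter W S for W :: "('w, 'b) monoid_scheme" (structure) and S +
  fixes C :: "'c set" and d :: "'c \<Rightarrow> 'c \<Rightarrow> 'w"
  assumes bld: "building W S C d"
begin

lemmas building_axioms = bld[unfolded building_def, THEN conjunct2]

lemma d_closed [simp]: "x \<in> C \<Longrightarrow> y \<in> C \<Longrightarrow> d x y \<in> carrier W"
  by (rule building_axioms[THEN conjunct1, rule_format])

lemma d_eq_one [simp]: "x \<in> C \<Longrightarrow> y \<in> C \<Longrightarrow> d x y = \<one> \<longleftrightarrow> x = y"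
  by (rule building_axioms[THEN conjunct2, THEN conjunct1, rule_format])

lemma d_self [simp]: "x \<in> C \<Longrightarrow> d x x = \<one>"
  by simp

lemma d_step:
  assumes "x \<in> C" "y \<in> C" "x' \<in> C" "d x' x \<in> S"
  shows "d x' y = d x' x \<otimes> d x y \<or> d x' y = d x y"
    and "len (d x' x \<otimes> d x y) = len (d x y) + 1 \<Longrightarrow> d x' y = d x' x \<otimes> d x y"
proof -
  note * = building_axioms[THEN conjunct2, THEN conjunct2, THEN conjunct1,
      THEN bspec, OF assms(1), THEN bspec, OF assms(2), THEN bspec, OF assms(3),
      THEN bspec, OF assms(4), THEN mp, OF refl]
  show "d x' y = d x' x \<otimes> d x y \<or> d x' y = d x y"
    using *[THEN conjunct1] by simp
  show "len (d x' x \<otimes> d x y) = len (d x y) + 1 \<Longrightarrow> d x' y = d x' x \<otimes> d x y"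
    by (rule *[THEN conjunct2, THEN mp])
qed

lemma d_ex: "x \<in> C \<Longrightarrow> y \<in> C \<Longrightarrow> s \<in> S \<Longrightarrow> \<exists>x'\<in>C. d x' x = s \<and> d x' y = s \<otimes> d x y"
  by (rule building_axioms[THEN conjunct2, THEN conjunct2, THEN conjunct2, THEN bspec, THEN bspec, THEN bspec])

lemma adj_sym:
  assumes "x \<in> C" "y \<in> C" "d x y \<in> S"
  shows "d y x = d x y"
proof -
  have "x \<noteq> y" using assms S_not_one by force
  hence "d y x \<noteq> \<one>" using assms by auto
  hence "d x y \<otimes> d y x = \<one>" using d_step(1)[of y x x] assms by (metis d_self)
  thus ?thesis using inv_equality[of "d x y" "d y x"] S_inv[of "d x y"] assms by (metis d_closed inv_inv)
qed

lemma panel_adj: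
  assumes "x \<in> C" "y \<in> C" "z \<in> C" "d x y \<in> S" "d x z = d x y" "y \<noteq> z"
  shows "d y z = d x y"
proof -
  have "d y x = d x y" using adj_sym assms by simp
  thus ?thesis using d_step(1)[of x z y] assms by auto
qed

fun gallery :: "'c \<Rightarrow> 'w list \<Rightarrow> 'c \<Rightarrow> bool" where
  "gallery x [] y \<longleftrightarrow> x \<in> C \<and> x = y"
| "gallery x (s # ws) y \<longleftrightarrow> x \<in> C \<and> s \<in> S \<and> (\<exists>z. d x z = s \<and> gallery z ws y)"

lemma gallery_dest: "gallery x ws y \<Longrightarrow> x \<in> C \<and> y \<in> C \<and> set ws \<subseteq> S"
  by (induction ws arbitrary: x) auto

lemma gallery_snoc: "gallery x ws y \<Longrightarrow> z \<in> C \<Longrightarrow> d y z = s \<Longrightarrow> s \<in> S \<Longrightarrow> gallery x (ws @ [s]) z"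
  by (induction ws arbitrary: x) auto

lemma gallery_rev: "gallery x ws y \<Longrightarrow> gallery y (rev ws) x"
proof (induction ws arbitrary: x)
  case (Cons s ws)
  then obtain z where z: "d x z = s" "gallery z ws y" by auto
  have "d z x = s" using adj_sym[of x z] z Cons.prems gallery_dest[OF z(2)] by auto
  thus ?case using gallery_snoc[OF Cons.IH[OF z(2)]] Cons.prems by auto
qed auto

lemma reduced_Cons:
  assumes "set (s # ws) \<subseteq> S" "len (wp (s # ws)) = length (s # ws)"
  shows "len (wp ws) = length ws"
  using assms len_le[of ws] len_mult[of s "wp ws"] by simp

lemma gallery_reduced:
  "gallery x ws y \<Longrightarrow> len (wp ws) = length ws \<Longrightarrow> d x y = wp ws"
proof (induction ws arbitrary: x)
  case (Cons s ws)
  then obtain z where z: "d x z = s" "gallery z ws y" and s: "s \<in> S" "x \<in> C" by auto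
  have l: "len (wp ws) = length ws"
    using reduced_Cons Cons.prems gallery_dest by blast
  hence "d z y = wp ws" using Cons.IH z by simp
  thus ?case using d_step(2)[of z y x] z s l Cons.prems gallery_dest[OF z(2)] by simp
qed (use d_eq_one in auto)

lemma ex_gallery:
  "x \<in> C \<Longrightarrow> y \<in> C \<Longrightarrow> set ws \<subseteq> S \<Longrightarrow> wp ws = d x y \<Longrightarrow> gallery x ws y"
proof (induction ws arbitrary: x)
  case (Cons s ws)
  hence s: "s \<in> S" "set ws \<subseteq> S" by auto
  obtain z where z: "z \<in> C" "d z x = s" "d z y = s \<otimes> d x y"
    using d_ex[OF Cons.prems(1,2) s(1)] by blast
  hence "d z y = wp ws" using Cons.prems(4)[symmetric] s by simp
  hence "gallery z ws y" using Cons z s by simp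
  moreover have "d x z = s" using adj_sym[of z x] z Cons s by simp
  ultimately show ?case using Cons.prems s by auto
qed (use d_eq_one in auto)

lemma min_gallery:
  assumes "x \<in> C" "y \<in> C"
  obtains ws where "gallery x ws y" "wp ws = d x y" "length ws = len (d x y)" "set ws \<subseteq> S"
  using ex_reduced_word[of "d x y"] ex_gallery[OF assms] assms by (metis d_closed)

lemma d_sym:
  assumes "x \<in> C" "y \<in> C"
  shows "d y x = inv (d x y)"
proof -
  obtain ws where ws: "gallery x ws y" "wp ws = d x y" "length ws = len (d x y)" "set ws \<subseteq> S"
    using min_gallery[OF assms] .
  have "wp (rev ws) = inv (d x y)" using word_prod_rev[of ws] ws by (auto simp: subset_iff)
  thus ?thesis using gallery_reduced[OF gallery_rev[OF ws(1)]] ws assms by simp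
qed

lemma d_step_right:
  assumes "x \<in> C" "y \<in> C" "y' \<in> C" "d y y' \<in> S"
  shows "d x y' = d x y \<otimes> d y y' \<or> d x y' = d x y"
    and "len (d x y \<otimes> d y y') = len (d x y) + 1 \<Longrightarrow> d x y' = d x y \<otimes> d y y'"
proof -
  have s: "d y' y = d y y'" using adj_sym assms by simp
  have i: "inv (d y y' \<otimes> d y x) = d x y \<otimes> d y y'" and x: "d x y' = inv (d y' x)"
    using assms d_sym[of y x] d_sym[of y' x] by (simp_all add: inv_mult_group)
  show "d x y' = d x y \<otimes> d y y' \<or> d x y' = d x y"
    using d_step(1)[of y x y'] assms i x d_sym[of y x] by (auto simp: s)
  assume "len (d x y \<otimes> d y y') = len (d x y) + 1"
  hence "len (d y y' \<otimes> d y x) = len (d y x) + 1"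
    using i d_sym[of y x] assms by (metis d_closed len_inv m_closed)
  thus "d x y' = d x y \<otimes> d y y'" using d_step(2)[of y x y'] assms i x by (simp add: s)
qed

text \<open>Along a gallery from \<open>y\<close> to \<open>z\<close> the distance from
  \<open>x\<close> either stays or is multiplied on the right by a generator. It has to cross the
  boundary of \<open>H\<close> somewhere, at a chamber at distance at most two from
  \<open>x\<close>, and \<open>y\<close> is no farther from that chamber than the gallery is
  long.\<close>

lemma separating_set_boundary:
  assumes H: "\<And>w r. w \<in> carrier W \<Longrightarrow> r \<in> S \<Longrightarrow> w \<in> H \<longleftrightarrow> w \<otimes> r \<notin> H \<Longrightarrow> len w \<le> 2"
    and x: "x \<in> C" "y \<in> C" "z \<in> C" and sep: "d x y \<in> H \<longleftrightarrow> d x z \<notin> H"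
  shows "len (d x y) \<le> len (d y z) + 2"
proof -
  have *: "gallery y ws z \<Longrightarrow> d x y \<in> H \<longleftrightarrow> d x z \<notin> H \<Longrightarrow> len (d x y) \<le> length ws + 2" for ws y
  proof (induction ws arbitrary: y)
    case (Cons s ws)
    then obtain y' where y': "d y y' = s" "gallery y' ws z" and s: "s \<in> S" "y \<in> C" by auto
    have c: "y' \<in> C" using gallery_dest[OF y'(2)] by simp
    have step: "d x y' = d x y \<otimes> s \<or> d x y' = d x y" using d_step_right(1)[of x y y'] x s c y' by simp
    show ?case
    proof (cases "d x y \<in> H \<longleftrightarrow> d x y' \<in> H")
      case True
      hence "len (d x y') \<le> length ws + 2" using Cons y' by simp
      moreover have "len (d x y) \<le> len (d x y \<otimes> s) + 1"
        using len_mult[of "d x y \<otimes> s" s] x s by simp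
      ultimately show ?thesis using step by auto
    next
      case False
      hence "len (d x y) \<le> 2" using H[of "d x y" s] step x s by auto
      thus ?thesis by simp
    qed
  qed auto
  obtain ws where "gallery y ws z" "length ws = len (d y z)" using min_gallery x by metis
  thus ?thesis using *[of y ws] sep by simp
qed

end

section \<open>Twin buildings and galleries of decreasing codistance\<close>

locale twin_chamber_system = coxeter W S for W :: "('w, 'b) monoid_scheme" (structure) and S +
  fixes Ca Cb :: "'c set" and da db ds :: "'c \<Rightarrow> 'c \<Rightarrow> 'w"
  assumes twin: "twin_building W S Ca Cb da db ds"
begin

sublocale A: chamber_system W S Ca da
  by unfold_locales (use twin in \<open>simp add: twin_building_def\<close>)

sublocale B: chamber_system W S Cb db
  by unfold_locales (use twin in \<open>simp add: twin_building_def\<close>)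

lemma flip: "twin_chamber_system W S Cb Ca db da ds"
  by unfold_locales (use twin in \<open>auto simp: twin_building_def\<close>)

lemmas half = twin[unfolded twin_building_def, THEN conjunct2, THEN conjunct2, THEN conjunct2,
  THEN conjunct1, unfolded twin_axioms_half_def]

lemma ds_closed [simp]: "x \<in> Ca \<Longrightarrow> y \<in> Cb \<Longrightarrow> ds x y \<in> carrier W"
  by (rule half[THEN conjunct1, THEN bspec, THEN bspec, THEN conjunct1])

lemma ds_sym: "x \<in> Ca \<Longrightarrow> y \<in> Cb \<Longrightarrow> ds y x = inv (ds x y)"
  by (rule half[THEN conjunct1, THEN bspec, THEN bspec, THEN conjunct2])

lemma ds_down:
  "x \<in> Ca \<Longrightarrow> y \<in> Cb \<Longrightarrow> x' \<in> Ca \<Longrightarrow> s \<in> S \<Longrightarrow> da x' x = s \<Longrightarrow>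
    len (s \<otimes> ds x y) + 1 = len (ds x y) \<Longrightarrow> ds x' y = s \<otimes> ds x y"
  by (rule half[THEN conjunct2, THEN conjunct1, THEN bspec, THEN bspec, THEN bspec, THEN bspec, THEN mp, OF _ _ _ _ conjI])

lemma ds_ex: "x \<in> Ca \<Longrightarrow> y \<in> Cb \<Longrightarrow> s \<in> S \<Longrightarrow> \<exists>x'\<in>Ca. da x' x = s \<and> ds x' y = s \<otimes> ds x y"
  by (rule half[THEN conjunct2, THEN conjunct2, THEN bspec, THEN bspec, THEN bspec])

text \<open>The axiom treats only steps that shorten the codistance. If \<open>s\<close> lengthens
  it, the panel has a chamber \<open>z\<close> of the longer codistance, and descending from
  \<open>z\<close> shows that all its other chambers share the codistance of
  \<open>x\<close>.\<close>

lemma ds_step: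
  assumes "x \<in> Ca" "y \<in> Cb" "x' \<in> Ca" "s \<in> S" "da x' x = s"
  shows "ds x' y = s \<otimes> ds x y \<or> ds x' y = ds x y"
proof (cases "len (s \<otimes> ds x y) + 1 = len (ds x y)")
  case False
  hence l: "len (s \<otimes> ds x y) = len (ds x y) + 1"
    using len_mult_S_cases[of s "ds x y"] assms by auto
  obtain z where z: "z \<in> Ca" "da z x = s" "ds z y = s \<otimes> ds x y" using ds_ex assms by blast
  show ?thesis
  proof (cases "x' = z")
    case False
    have "da x x' = s" "da x z = s" using A.adj_sym[of x' x] A.adj_sym[of z x] assms z by auto
    hence "da x' z = s" using A.panel_adj[of x x' z] assms z False by simp
    hence "ds x' y = s \<otimes> ds z y" using ds_down[of z y x' s] assms z l by simp
    thus ?thesis using z assms by simp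
  qed (use z in simp)
qed (use ds_down assms in simp)

lemma len_ds_left:
  assumes "x \<in> Ca" "x' \<in> Ca" "y \<in> Cb"
  shows "len (ds x y) \<le> len (ds x' y) + len (da x x')"
proof -
  have *: "A.gallery x ws x' \<Longrightarrow> len (ds x y) \<le> len (ds x' y) + length ws" for ws x
  proof (induction ws arbitrary: x)
    case (Cons s ws)
    then obtain z where z: "da x z = s" "A.gallery z ws x'" and s: "s \<in> S" "x \<in> Ca" by auto
    have c: "z \<in> Ca" using A.gallery_dest[OF z(2)] by simp
    have "ds x y = s \<otimes> ds z y \<or> ds x y = ds z y" using ds_step[of z y x s] z s c assms by simp
    moreover have "len (s \<otimes> ds z y) \<le> len (ds z y) + 1" using len_mult[of s "ds z y"] s c assms by simp
    ultimately show ?case using Cons.IH[OF z(2)] by auto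
  qed auto
  thus ?thesis using A.min_gallery[OF assms(1,2)] by metis
qed

lemma len_ds_right:
  assumes "x \<in> Ca" "y \<in> Cb" "y' \<in> Cb"
  shows "len (ds x y) \<le> len (ds x y') + len (db y y')"
  using twin_chamber_system.len_ds_left[OF flip assms(2,3,1)] ds_sym assms by simp

text \<open>Additivity of lengths makes every step of the gallery a descent, and descents are the
  steps whose codistance the axioms determine.\<close>

lemma descending_gallery:
  assumes "A.gallery x ws x'" "y \<in> Cb" "v \<in> carrier W" "ds x y = wp ws \<otimes> v"
    "len (wp ws \<otimes> v) = length ws + len v"
  shows "ds x' y = v"
  using assms
proof (induction ws arbitrary: x)
  case (Cons s ws)
  then obtain z where z: "da x z = s" "A.gallery z ws x'" and s: "s \<in> S" "x \<in> Ca" by auto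
  have c: "z \<in> Ca" "set ws \<subseteq> S" using A.gallery_dest[OF z(2)] by auto
  have eq: "s \<otimes> ds x y = wp ws \<otimes> v" using Cons.prems s c by (simp add: m_assoc)
  have "len (wp ws \<otimes> v) \<le> length ws + len v"
    using len_mult[of "wp ws" v] len_le[of ws] c Cons.prems by simp
  moreover have l: "len (ds x y) = Suc (length ws + len v)" using Cons.prems by simp
  moreover have "len (ds x y) \<le> 1 + len (wp ws \<otimes> v)"
    using len_mult[of s "wp ws \<otimes> v"] eq s c Cons.prems by (metis S_cancel(1) S_closed ds_closed len_S m_closed wp_closed)
  ultimately have l2: "len (wp ws \<otimes> v) = length ws + len v" by simp
  have "da z x = s" using A.adj_sym[of x z] z s c by simp
  hence "ds z y = wp ws \<otimes> v" using ds_down[of x y z s] s c Cons.prems eq l l2 by simp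
  thus ?case using Cons.IH[OF z(2)] Cons.prems l2 by simp
qed simp

lemma descending_gallery_right:
  assumes "B.gallery y ws y'" "x \<in> Ca" "v \<in> carrier W" "ds x y = v \<otimes> inv (wp ws)"
    "len (v \<otimes> inv (wp ws)) = length ws + len v"
  shows "ds x y' = v"
proof -
  have c: "set ws \<subseteq> S" "y \<in> Cb" "y' \<in> Cb" using B.gallery_dest[OF assms(1)] by auto
  have e: "inv (v \<otimes> inv (wp ws)) = wp ws \<otimes> inv v" using assms c by (simp add: inv_mult_group)
  have "ds y x = wp ws \<otimes> inv v" using ds_sym[of x y] assms e c by simp
  moreover have "len (wp ws \<otimes> inv v) = length ws + len (inv v)"
    using assms c by (metis e inv_closed len_inv m_closed wp_closed)
  ultimately have "ds y' x = inv v"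
    using twin_chamber_system.descending_gallery[OF flip assms(1,2), of "inv v"] assms by simp
  thus ?thesis using ds_sym[of x y'] assms c by (metis ds_closed inv_inv)
qed

end

lemma (in coxeter) ex_last_letter:
  assumes "w \<in> carrier W" "len w = Suc n"
  obtains v s where "v \<in> carrier W" "s \<in> S" "w = v \<otimes> s" "len v = n"
proof -
  obtain ws where ws: "set ws \<subseteq> S" "wp ws = w" "length ws = len w" using ex_reduced_word assms by blast
  then obtain vs s where vs: "ws = vs @ [s]" using assms by (metis append_butlast_last_id list.size(3) nat.distinct(1))
  hence s: "s \<in> S" "set vs \<subseteq> S" "w = wp vs \<otimes> s" using ws by (auto simp: wp_append)
  have "len (wp vs) \<le> n" using len_le[of vs] ws vs s assms by simp
  moreover have "len w \<le> len (wp vs) + 1" using len_mult[of "wp vs" s] s by simp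
  ultimately show thesis using that[of "wp vs" s] s assms by simp
qed

section \<open>The twin apartment through an opposite pair\<close>

context twin_chamber_system
begin

text \<open>For opposite \<open>x\<close> and \<open>y\<close> this addresses the chambers of their
  twin apartment that lie in \<open>Ca\<close>. Many chambers are at distance \<open>w\<close> from
  \<open>x\<close>; the codistance to \<open>y\<close> singles out one of them.\<close>

definition on_apartment :: "'c \<Rightarrow> 'c \<Rightarrow> 'w \<Rightarrow> 'c \<Rightarrow> bool" where
  "on_apartment x y w z \<longleftrightarrow> z \<in> Ca \<and> da x z = w \<and> ds z y = inv w"

lemma on_apartment_ascend:
  assumes xy: "x \<in> Ca" "y \<in> Cb" and w: "w \<in> carrier W" "s \<in> S" "len (w \<otimes> s) = len w + 1"
    and z: "on_apartment x y w z"
  shows "\<exists>z'. on_apartment x y (w \<otimes> s) z' \<and> da z z' = s"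
proof -
  obtain z' where z': "z' \<in> Ca" "da z' z = s" "ds z' y = s \<otimes> ds z y"
    using ds_ex[of z y s] z xy w by (auto simp: on_apartment_def)
  have "da z z' = s" using A.adj_sym[of z' z] z' z w by (simp add: on_apartment_def)
  moreover have "da x z' = w \<otimes> s"
    using A.d_step_right(2)[of x z z'] calculation z z' w xy by (simp add: on_apartment_def)
  moreover have "ds z' y = inv (w \<otimes> s)" using z z' w by (simp add: on_apartment_def inv_mult_group)
  ultimately show ?thesis using z' by (auto simp: on_apartment_def)
qed

text \<open>For uniqueness, write \<open>w = v \<otimes> s\<close> with \<open>v\<close> shorter.
  Every candidate for \<open>w\<close> is \<open>s\<close>-adjacent to the chamber \<open>p\<close>
  already known for \<open>v\<close>. Two distinct candidates would be \<open>s\<close>-adjacent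
  with the same codistance \<open>inv w\<close>, although \<open>s\<close> shortens
  \<open>inv w\<close> and so forces it to change.\<close>

lemma ex1_on_apartment:
  assumes xy: "x \<in> Ca" "y \<in> Cb" "ds x y = \<one>" and w: "w \<in> carrier W"
  shows "\<exists>!z. on_apartment x y w z"
  using w
proof (induction "len w" arbitrary: w)
  case 0
  hence "w = \<one>" using len_eq_0[of w] by simp
  thus ?case using xy A.d_eq_one[of x] by (intro ex1I[of _ x]) (auto simp: on_apartment_def)
next
  case (Suc n)
  obtain v s where v: "v \<in> carrier W" "s \<in> S" "w = v \<otimes> s" "len v = n"
    using ex_last_letter[of w n] Suc by metis
  have vw: "v = w \<otimes> s" using v by simp
  obtain p where p: "on_apartment x y v p" and p_unique: "\<And>z. on_apartment x y v z \<Longrightarrow> z = p"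
    using Suc(1)[of v] v by metis
  have "\<exists>z. on_apartment x y w z" using on_apartment_ascend[OF xy(1,2) v(1,2) _ p] v Suc by auto
  moreover have adj: "da p z = s" if z: "on_apartment x y w z" for z
  proof -
    obtain p' where p': "p' \<in> Ca" "da p' z = s" "da p' x = s \<otimes> da z x"
      using A.d_ex[of z x s] z xy v by (auto simp: on_apartment_def)
    have iv: "s \<otimes> inv w = inv v" using v by (simp add: inv_mult_group)
    have "da z x = inv w" using A.d_sym[of x z] z xy by (simp add: on_apartment_def)
    hence "da p' x = inv v" using p' iv by simp
    hence "da x p' = v" using A.d_sym[of p' x] p' xy v by simp
    moreover have "ds p' y = s \<otimes> ds z y"
      using ds_down[of z y p' s] z p' xy v iv Suc(2) by (simp add: on_apartment_def)
    ultimately have "on_apartment x y v p'" using z p' iv by (simp add: on_apartment_def)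
    thus ?thesis using p_unique p' by auto
  qed
  moreover have "z = z'" if z: "on_apartment x y w z" "on_apartment x y w z'" for z z'
  proof (rule ccontr)
    assume "z \<noteq> z'"
    have c: "p \<in> Ca" "z \<in> Ca" "z' \<in> Ca" using p z by (auto simp: on_apartment_def)
    have "da z z' = s" using A.panel_adj[of p z z'] adj z c v \<open>z \<noteq> z'\<close> by simp
    hence "da z' z = s" using A.adj_sym[of z z'] c v(2) by simp
    have iv: "s \<otimes> inv w = inv v" using v by (simp add: inv_mult_group)
    have zz: "ds z y = inv w" "ds z' y = inv w" using z by (simp_all add: on_apartment_def)
    have "len (s \<otimes> ds z y) + 1 = len (ds z y)"
      unfolding zz iv using v(1,4) Suc(2,3) by simp
    hence "ds z' y = s \<otimes> ds z y"
      by (rule ds_down[OF c(2) xy(2) c(3) v(2) \<open>da z' z = s\<close>])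
    hence "inv v = inv w" using zz iv by simp
    hence "v = w" using v(1) Suc(3) by (metis inv_inv)
    thus False using v(4) Suc(2) by simp
  qed
  ultimately show ?case by blast
qed

definition ap :: "'c \<Rightarrow> 'c \<Rightarrow> 'w \<Rightarrow> 'c" where
  "ap x y w = (THE z. on_apartment x y w z)"

context
  fixes x y assumes xy: "x \<in> Ca" "y \<in> Cb" "ds x y = \<one>"
begin

lemma on_apartment_iff: "w \<in> carrier W \<Longrightarrow> on_apartment x y w z \<longleftrightarrow> z = ap x y w"
  using theI'[OF ex1_on_apartment[OF xy, of w]] ex1_on_apartment[OF xy, of w]
  unfolding ap_def by blast

lemma ap: "w \<in> carrier W \<Longrightarrow> ap x y w \<in> Ca" "w \<in> carrier W \<Longrightarrow> da x (ap x y w) = w"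
  "w \<in> carrier W \<Longrightarrow> ds (ap x y w) y = inv w"
  using on_apartment_iff[of w "ap x y w"] by (auto simp: on_apartment_def)

lemma ap_one: "ap x y \<one> = x"
  using on_apartment_iff[of \<one> x] xy by (simp add: on_apartment_def)

lemma ap_adj:
  assumes w: "w \<in> carrier W" and s: "s \<in> S"
  shows "da (ap x y w) (ap x y (w \<otimes> s)) = s"
proof -
  have up: "da (ap x y w) (ap x y (w \<otimes> s)) = s" if w: "w \<in> carrier W" and "len (w \<otimes> s) = len w + 1" for w
    using on_apartment_ascend[OF xy(1,2) w s that(2), of "ap x y w"] on_apartment_iff w s by auto
  have i: "len (w \<otimes> s) = len w + 1 \<or> len w = len (w \<otimes> s) + 1"
    using len_mult_S_cases[of s "inv w"] w s len_inv[of "w \<otimes> s"] by (simp add: inv_mult_group)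
  thus ?thesis
  proof
    assume "len w = len (w \<otimes> s) + 1"
    hence "da (ap x y (w \<otimes> s)) (ap x y w) = s" using up[of "w \<otimes> s"] w s by simp
    thus ?thesis using A.adj_sym[of "ap x y (w \<otimes> s)" "ap x y w"] ap w s by simp
  qed (use up w in simp)
qed

lemma ap_gallery:
  "u \<in> carrier W \<Longrightarrow> set ws \<subseteq> S \<Longrightarrow> A.gallery (ap x y u) ws (ap x y (u \<otimes> wp ws))"
proof (induction ws arbitrary: u)
  case (Cons s ws)
  thus ?case using ap_adj[of u s] Cons.IH[of "u \<otimes> s"] ap(1)[of u] by (auto simp: m_assoc)
qed (use ap in simp)

lemma ap_isometry:
  assumes "u \<in> carrier W" "v \<in> carrier W"
  shows "da (ap x y u) (ap x y v) = inv u \<otimes> v"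
proof -
  obtain ws where ws: "set ws \<subseteq> S" "wp ws = inv u \<otimes> v" "length ws = len (inv u \<otimes> v)"
    using ex_reduced_word[of "inv u \<otimes> v"] assms by auto
  have "u \<otimes> wp ws = v" using ws assms by (simp add: m_assoc[symmetric])
  thus ?thesis using A.gallery_reduced[OF ap_gallery[OF assms(1) ws(1)]] ws by simp
qed

end

text \<open>Both chambers of the half-apartments are compared along galleries of decreasing codistance.
  In the only critical case such a gallery would end in an opposite pair
  \<open>(ap x y (u s), ap y x u)\<close>, whose codistance is known to be \<open>s\<close>.\<close>

lemma ap_codistance:
  assumes xy: "x \<in> Ca" "y \<in> Cb" "ds x y = \<one>" and "u \<in> carrier W" "v \<in> carrier W"
  shows "ds (ap x y u) (twin_chamber_system.ap W Cb db ds y x v) = inv u \<otimes> v"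
proof -
  interpret F: twin_chamber_system W S Cb Ca db da ds by (rule flip)
  have yx: "y \<in> Cb" "x \<in> Ca" "ds y x = \<one>" using xy ds_sym by auto
  note ap = ap[OF xy] and ap' = F.ap[OF yx] and gal = ap_gallery[OF xy] and gal' = F.ap_gallery[OF yx]
  let ?P = "\<lambda>u v. ds (ap x y u) (F.ap y x v) = inv u \<otimes> v"
  have P1: "?P \<one> v" if "v \<in> carrier W" for v
    using ap'(3)[OF that] ds_sym[OF xy(1) ap'(1)[OF that]] ap_one[OF xy] that xy
    by (metis ap'(1) ds_closed inv_inv inv_one l_one)
  have P1': "?P u \<one>" if "u \<in> carrier W" for u
    using ap(3)[OF that] F.ap_one[OF yx] that by simp
  \<comment> \<open>Start from a pair containing a base chamber, where the codistance is known: the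
    half with the longer of \<open>u\<close> and \<open>u \<otimes> s\<close> stays fixed, and in
    the other half one walks out from the base chamber. Every step then descends and the letter
    \<open>s\<close> is left over.\<close>
  have diag: "ds (ap x y (u \<otimes> s)) (F.ap y x u) = s" if u: "u \<in> carrier W" and s: "s \<in> S" for u s
  proof (cases "len (u \<otimes> s) = len u + 1")
    case True
    obtain ws where ws: "set ws \<subseteq> S" "wp ws = u" "length ws = len u" using ex_reduced_word[OF u] .
    have "B.gallery (F.ap y x \<one>) ws (F.ap y x u)" using gal'[of \<one> ws] ws u by simp
    moreover have e: "s \<otimes> inv u = inv (u \<otimes> s)" using u s by (simp add: inv_mult_group)
    have "ds (ap x y (u \<otimes> s)) (F.ap y x \<one>) = s \<otimes> inv (wp ws)" using P1'[of "u \<otimes> s"] e u s ws by simp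
    moreover have "len (s \<otimes> inv (wp ws)) = length ws + len s"
      unfolding ws(2) e using True u s ws by simp
    ultimately show ?thesis using descending_gallery_right ap(1) u s by simp
  next
    case False
    have "len (u \<otimes> s) = len u + 1 \<or> len u = len (u \<otimes> s) + 1"
      using len_mult_S_cases[of s "inv u"] u s len_inv[of "u \<otimes> s"] by (simp add: inv_mult_group)
    hence l: "len u = len (u \<otimes> s) + 1" using False by simp
    have us: "u \<otimes> s \<in> carrier W" using u s by simp
    obtain ws where ws: "set ws \<subseteq> S" "wp ws = u \<otimes> s" "length ws = len (u \<otimes> s)" using ex_reduced_word[OF us] .
    have "A.gallery (ap x y \<one>) ws (ap x y (u \<otimes> s))" using gal[of \<one> ws] ws us by simp
    moreover have "ds (ap x y \<one>) (F.ap y x u) = wp ws \<otimes> s" using P1[of u] ws u s by simp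
    moreover have "len (wp ws \<otimes> s) = length ws + len s" using ws u s l by simp
    ultimately show ?thesis using descending_gallery ap'(1) u s by simp
  qed
  have "?P u v" if "u \<in> carrier W" "v \<in> carrier W" for u v
    using that
  proof (induction "len u" arbitrary: u)
    case 0
    thus ?case using len_eq_0[of u] P1 by simp
  next
    case (Suc n)
    obtain w s where w: "w \<in> carrier W" "s \<in> S" "u = w \<otimes> s" "len w = n"
      using ex_last_letter[of u n] Suc by metis
    let ?a = "inv w \<otimes> v" and ?z = "ap x y u" and ?z' = "F.ap y x v"
    have IH: "ds (ap x y w) ?z' = ?a" using Suc(1)[of w] w Suc.prems by simp
    have a: "?a \<in> carrier W" and sa: "s \<otimes> ?a = inv u \<otimes> v"
      using w Suc.prems by (simp_all add: inv_mult_group m_assoc)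
    have c: "ap x y w \<in> Ca" "?z \<in> Ca" "?z' \<in> Cb" using ap(1) ap'(1) w Suc.prems by simp_all
    have adj: "da ?z (ap x y w) = s"
      using ap_adj[OF xy w(1,2)] A.adj_sym[of "ap x y w" ?z] c w by simp
    consider "ds ?z ?z' = s \<otimes> ?a" | "ds ?z ?z' = ?a"
      using ds_step[OF c(1,3,2) w(2) adj] IH by auto
    thus ?case
    proof cases
      case 2
      obtain ws where ws: "set ws \<subseteq> S" "wp ws = inv ?a" "length ws = len (inv ?a)"
        using ex_reduced_word[of "inv ?a"] a by auto
      have "v \<otimes> wp ws = w" using ws w Suc.prems by (simp add: inv_mult_group m_assoc[symmetric])
      hence "B.gallery ?z' ws (F.ap y x w)" using gal'[OF Suc.prems(2) ws(1)] by simp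
      hence "ds ?z (F.ap y x w) = \<one>"
        using descending_gallery_right[of ?z' ws "F.ap y x w" ?z \<one>] 2 ws a c by simp
      hence False using diag[OF w(1,2)] w S_not_one by simp
      thus ?thesis ..
    qed (use sa in simp)
  qed
  thus ?thesis using assms by simp
qed

lemma ex_twin_apartment:
  assumes xy: "x \<in> Ca" "y \<in> Cb" "ds x y = \<one>"
  obtains f where "twin_apartment W Ca Cb da db ds (f ` (carrier W \<times> UNIV))"
    "f (\<one>, True) = x" "f (\<one>, False) = y"
proof -
  interpret F: twin_chamber_system W S Cb Ca db da ds by (rule flip)
  have yx: "y \<in> Cb" "x \<in> Ca" "ds y x = \<one>" using xy ds_sym by auto
  define f where "f = (\<lambda>(w, b). if b then ap x y w else F.ap y x w)"
  have "twin_apartment W Ca Cb da db ds (f ` (carrier W \<times> UNIV))"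
    unfolding twin_apartment_def
    by (rule exI[of _ f])
      (use ap[OF xy] F.ap[OF yx] ap_isometry[OF xy] F.ap_isometry[OF yx] ap_codistance[OF xy]
        in \<open>simp add: f_def\<close>)
  thus thesis using that[of f] ap_one[OF xy] F.ap_one[OF yx] by (simp add: f_def)
qed

end

text \<open>In the model, \<open>(u, True)\<close> is opposite to \<open>(u, False)\<close> and to
  no other chamber. Disjointness of the two halves is what recovers the sign of a chamber of the
  apartment.\<close>

lemma twin_apartment_opposite_unique:
  assumes W: "group W" and "twin_apartment W Ca Cb da db ds A" and disj: "Ca \<inter> Cb = {}"
    and x: "x \<in> A" "x \<in> Ca" and y: "y \<in> A" "y \<in> Cb" "z \<in> A" "z \<in> Cb"
    and opp: "ds x y = \<one>\<^bsub>W\<^esub>" "ds x z = \<one>\<^bsub>W\<^esub>"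
  shows "y = z"
proof -
  interpret group W by (rule W)
  obtain f where f: "A = f ` (carrier W \<times> UNIV)"
    "\<And>u. u \<in> carrier W \<Longrightarrow> f (u, True) \<in> Ca \<and> f (u, False) \<in> Cb"
    "\<And>u v. u \<in> carrier W \<Longrightarrow> v \<in> carrier W \<Longrightarrow> ds (f (u, True)) (f (v, False)) = inv\<^bsub>W\<^esub> u \<otimes>\<^bsub>W\<^esub> v"
    using assms(2) unfolding twin_apartment_def by metis
  have pos: "\<exists>u\<in>carrier W. z = f (u, z \<in> Ca)" if "z \<in> A" for z
  proof -
    obtain u b where u: "u \<in> carrier W" "z = f (u, b)" using \<open>z \<in> A\<close> unfolding f(1) by blast
    have "z \<in> Ca \<longleftrightarrow> b" using f(2)[OF u(1)] u(2) disj by (cases b) auto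
    thus ?thesis using u by auto
  qed
  obtain u where u: "u \<in> carrier W" "x = f (u, True)" using pos[OF x(1)] x(2) by auto
  have *: "\<exists>v\<in>carrier W. v = u \<and> z = f (v, False)" if z: "z \<in> A" "z \<in> Cb" "ds x z = \<one>\<^bsub>W\<^esub>" for z
  proof -
    have nz: "z \<notin> Ca" using z(2) disj by auto
    obtain v where v: "v \<in> carrier W" "z = f (v, False)" using pos[OF z(1)] nz by auto
    hence "inv\<^bsub>W\<^esub> u \<otimes>\<^bsub>W\<^esub> v = \<one>\<^bsub>W\<^esub>" using f(3) u z(3) by simp
    hence "v = u" using u v by (metis inv_equality inv_inv inv_closed)
    thus ?thesis using v by auto
  qed
  show ?thesis using *[OF y(1,2) opp(1)] *[OF y(3,4) opp(2)] by auto
qed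

text \<open>Strong transitivity moves an apartment together with one chamber \<open>x\<close>. The
  second chamber \<open>y\<close> follows, as the only chamber of the apartment opposite to
  \<open>x\<close>.\<close>

lemma (in twin_chamber_system) opposite_pairs_transitive:
  assumes G: "strongly_transitive G \<phi> W Ca Cb da db ds"
    and xy: "x \<in> Ca" "y \<in> Cb" "ds x y = \<one>" and xy': "x' \<in> Ca" "y' \<in> Cb" "ds x' y' = \<one>"
  obtains g where "g \<in> carrier G" "\<phi> g x = x'" "\<phi> g y = y'"
proof -
  obtain f where f: "twin_apartment W Ca Cb da db ds (f ` (carrier W \<times> UNIV))"
    "f (\<one>, True) = x" "f (\<one>, False) = y" using ex_twin_apartment[OF xy] .
  obtain f' where f': "twin_apartment W Ca Cb da db ds (f' ` (carrier W \<times> UNIV))"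
    "f' (\<one>, True) = x'" "f' (\<one>, False) = y'" using ex_twin_apartment[OF xy'] .
  have mem: "x \<in> f ` (carrier W \<times> UNIV)" "y \<in> f ` (carrier W \<times> UNIV)"
    "x' \<in> f' ` (carrier W \<times> UNIV)" "y' \<in> f' ` (carrier W \<times> UNIV)"
    unfolding f(2,3)[symmetric] f'(2,3)[symmetric] by auto
  obtain g where g: "g \<in> carrier G" "\<phi> g ` f ` (carrier W \<times> UNIV) = f' ` (carrier W \<times> UNIV)" "\<phi> g x = x'"
    using G[unfolded strongly_transitive_def, THEN conjunct2, THEN conjunct2, rule_format, of _ _ x x'] f f' mem xy xy'
    by (metis IntI)
  have "\<phi> g y \<in> f' ` (carrier W \<times> UNIV)" using mem(2) g(2) by blast
  moreover have "\<phi> g ` Cb = Cb \<and> (\<forall>x\<in>Ca \<union> Cb. \<forall>y\<in>Ca \<union> Cb. ds (\<phi> g x) (\<phi> g y) = ds x y)"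
    using G[unfolded strongly_transitive_def, THEN conjunct2, THEN conjunct1, THEN bspec, OF g(1)] by (elim conjE) (intro conjI)
  hence "\<phi> g y \<in> Cb" "ds (\<phi> g x) (\<phi> g y) = ds x y" using xy by blast+
  moreover have "Ca \<inter> Cb = {}" using twin by (simp add: twin_building_def)
  ultimately have "\<phi> g y = y'"
    using twin_apartment_opposite_unique[OF is_group f'(1), of x' "\<phi> g y" y'] mem xy xy' g(3) by simp
  thus thesis using that g by blast
qed

section \<open>Alternating galleries\<close>

text \<open>Letters carry absolute positions, so that subwords are intervals of indices and no
  parity has to be tracked when a word is cut.\<close>

definition zig :: "'s \<Rightarrow> 's \<Rightarrow> nat \<Rightarrow> 's" where
  "zig a b k = (if even k then a else b)"

lemma map_zig: "map (zig a b) [i..<i + n] = alt_word (zig a b i) (zig a b (Suc i)) n"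
proof (induction n arbitrary: i)
  case (Suc n)
  have "zig a b (Suc (Suc i)) = zig a b i" by (simp add: zig_def)
  thus ?case using Suc[of "Suc i"] by (simp add: upt_conv_Cons del: upt_Suc)
qed simp

text \<open>An alternating word of odd length is a palindrome.\<close>

lemma rev_map_zig:
  assumes "odd K" "j \<le> K"
  shows "rev (map (zig a b) [0..<j]) = map (zig a b) [K - j..<K]"
proof (rule nth_equalityI)
  fix i assume "i < length (rev (map (zig a b) [0..<j]))"
  hence i: "i < j" by simp
  hence "even (j - Suc i) \<longleftrightarrow> even (K - j + i)" using assms by presburger
  thus "rev (map (zig a b) [0..<j]) ! i = map (zig a b) [K - j..<K] ! i"
    using i assms by (simp add: rev_nth zig_def)
qed (use assms in simp)

context coxeter
begin

lemma len_map_zig: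
  assumes "a \<in> S" "b \<in> S" "cox_m W a b = 0" "i \<le> j"
  shows "len (wp (map (zig a b) [i..<j])) = j - i"
  using len_alt_word[of a b "j - i"] len_alt_word[of b a "j - i"] cox_m_commute[of a b] assms
    map_zig[of a b i "j - i"] by (auto simp: zig_def)

lemma zig_in: "a \<in> S \<Longrightarrow> b \<in> S \<Longrightarrow> zig a b k \<in> S"
  by (simp add: zig_def)

lemma set_map_zig: "a \<in> S \<Longrightarrow> b \<in> S \<Longrightarrow> set (map (zig a b) ks) \<subseteq> S"
  by (auto simp: zig_def)

lemma wp_map_zig_append:
  assumes "a \<in> S" "b \<in> S" "i \<le> j" "j \<le> k"
  shows "wp (map (zig a b) [i..<k]) = wp (map (zig a b) [i..<j]) \<otimes> wp (map (zig a b) [j..<k])"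
proof -
  have "[i..<k] = [i..<j] @ [j..<k]" using upt_add_eq_append[of i j "k - j"] assms by simp
  thus ?thesis using wp_append[OF set_map_zig set_map_zig, of a b a b] assms by simp
qed

end

context chamber_system
begin

definition zigzag :: "'w \<Rightarrow> 'w \<Rightarrow> (nat \<Rightarrow> 'c) \<Rightarrow> bool" where
  "zigzag a b \<xi> \<longleftrightarrow> (\<forall>k. \<xi> k \<in> C \<and> d (\<xi> k) (\<xi> (Suc k)) = zig a b k)"

lemma ex_adj: "x \<in> C \<Longrightarrow> s \<in> S \<Longrightarrow> \<exists>y\<in>C. d x y = s"
  using d_ex[of x x s] adj_sym by metis

lemma ex_zigzag:
  assumes ab: "a \<in> S" "b \<in> S" and x: "x \<in> C" "y \<in> C" "d x y = a"
  obtains \<xi> where "zigzag a b \<xi>" "\<xi> 0 = x" "\<xi> 1 = y"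
proof -
  obtain nxt where nxt: "\<And>z s. z \<in> C \<Longrightarrow> s \<in> S \<Longrightarrow> nxt z s \<in> C \<and> d z (nxt z s) = s"
    using ex_adj by metis
  define \<xi> where "\<xi> = rec_nat x (\<lambda>k z. if k = 0 then y else nxt z (zig a b k))"
  have in_C: "\<xi> k \<in> C" for k
    by (induction k) (use x nxt zig_in ab in \<open>simp_all add: \<xi>_def\<close>)
  have "d (\<xi> k) (\<xi> (Suc k)) = zig a b k" for k
    using nxt[OF in_C[of k] zig_in[OF ab, of k]] x by (cases "k = 0") (simp_all add: \<xi>_def zig_def)
  thus thesis using that[of \<xi>] in_C by (simp add: zigzag_def \<xi>_def)
qed

lemma zigzag_gallery:
  assumes "a \<in> S" "b \<in> S" "zigzag a b \<xi>" "i \<le> j"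
  shows "gallery (\<xi> i) (map (zig a b) [i..<j]) (\<xi> j)"
  using assms(4)
proof (induction rule: dec_induct)
  case (step n)
  thus ?case using gallery_snoc[of "\<xi> i" "map (zig a b) [i..<n]" "\<xi> n" "\<xi> (Suc n)" "zig a b n"] assms zig_in
    by (simp add: zigzag_def)
qed (use assms in \<open>simp add: zigzag_def\<close>)

text \<open>Thickness gives two chambers \<open>p\<close> and \<open>q\<close> besides
  \<open>x\<close> in the \<open>a\<close>-panel, and the rays leave \<open>x\<close> through one
  each. Seen from \<open>p\<close>, the first ray continues with a word that begins with
  \<open>b\<close>, while the second first crosses the panel to \<open>q\<close> and so has a word
  that begins with \<open>a\<close>. Hence they lie on opposite sides of \<open>H\<close>, apart
  from the first two chambers of the first ray.\<close>

lemma branching_zigzags: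
  assumes ab: "a \<in> S" "b \<in> S" "cox_m W a b = 0" and x: "x \<in> C" and thick: "2 < card (panel W C d a x)"
    and H: "\<And>n. wp (alt_word a b n) \<notin> H" "\<And>n. n > 0 \<Longrightarrow> wp (alt_word b a n) \<in> H"
  obtains \<xi> \<eta> where "zigzag a b \<xi>" "zigzag a b \<eta>" "\<xi> 0 = x" "\<eta> 0 = x"
    "\<And>k. d (\<xi> 1) (\<xi> k) \<in> H \<longleftrightarrow> k \<ge> 2" "\<And>k. d (\<xi> 1) (\<eta> k) \<notin> H"
proof -
  have "\<exists>y\<in>panel W C d a x. y \<notin> {x, z}" for z
  proof (rule ccontr)
    assume "\<not> (\<exists>y\<in>panel W C d a x. y \<notin> {x, z})"
    hence "card (panel W C d a x) \<le> card {x, z}" by (intro card_mono) auto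
    also have "\<dots> \<le> 2" by (simp add: card_insert_if)
    finally show False using thick by simp
  qed
  then obtain p q where p: "p \<in> panel W C d a x" "p \<noteq> x" and q: "q \<in> panel W C d a x" "q \<noteq> x" "q \<noteq> p"
    by (metis insertCI)
  hence pC: "p \<in> C" "d x p = a" and qC: "q \<in> C" "d x q = a"
    using x by (auto simp: panel_def)
  obtain \<xi> where \<xi>: "zigzag a b \<xi>" "\<xi> 0 = x" "\<xi> 1 = p" using ex_zigzag[OF ab(1,2) x pC] .
  obtain \<eta> where \<eta>: "zigzag a b \<eta>" "\<eta> 0 = x" "\<eta> 1 = q" using ex_zigzag[OF ab(1,2) x qC] .
  have ba: "cox_m W b a = 0" using cox_m_commute[OF ab(1,2)] ab(3) by simp
  have px: "d p x = a" using adj_sym[of x p] x pC ab by simp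
  have word: "map (zig a b) [1..<k] = alt_word b a (k - 1)" if "k \<ge> 1" for k
    using map_zig[of a b 1 "k - 1"] that by (simp add: zig_def)
  have x_H: "d p x \<notin> H" using H(1)[of 1] ab px by simp
  have \<xi>H: "d (\<xi> 1) (\<xi> k) \<in> H \<longleftrightarrow> k \<ge> 2" for k
  proof (cases "k = 0")
    case False
    have "d (\<xi> 1) (\<xi> k) = wp (alt_word b a (k - 1))"
      using gallery_reduced[OF zigzag_gallery[OF ab(1,2) \<xi>(1), of 1 k]] False word[of k]
        len_alt_word[OF ab(2,1) ba, of "k - 1"] by simp
    thus ?thesis using H(1)[of 0] H(2)[of "k - 1"] False by (cases "k = 1") auto
  qed (use \<xi> x_H in simp)
  have \<eta>H: "d (\<xi> 1) (\<eta> k) \<notin> H" for k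
  proof (cases "k = 0")
    case False
    have "d p q = a" using panel_adj[of x p q] x pC qC q ab by simp
    hence "gallery p (a # alt_word b a (k - 1)) (\<eta> k)"
      using zigzag_gallery[OF ab(1,2) \<eta>(1), of 1 k] False word[of k] \<eta>(3) pC ab by auto
    moreover have "a # alt_word b a (k - 1) = alt_word a b k" using False by (cases k) auto
    ultimately have "gallery p (alt_word a b k) (\<eta> k)" by (simp only:)
    hence "d p (\<eta> k) = wp (alt_word a b k)"
      using gallery_reduced[of p "alt_word a b k" "\<eta> k"] len_alt_word[OF ab, of k] by simp
    thus ?thesis using H(1)[of k] \<xi> by simp
  qed (use \<eta> \<xi> x_H in simp)
  show thesis using that[OF \<xi>(1) \<eta>(1) \<xi>(2) \<eta>(2) \<xi>H \<eta>H] .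
qed

end

context twin_chamber_system
begin

lemma ex_codistance:
  assumes "x \<in> Ca" "y \<in> Cb" "ds x y = \<one>" "set ws \<subseteq> S"
  shows "\<exists>x'\<in>Ca. ds x' y = wp ws"
  using assms(4)
proof (induction ws)
  case (Cons s ws)
  then obtain z where "z \<in> Ca" "ds z y = wp ws" by auto
  thus ?case using ds_ex[of z y s] assms(2) Cons.prems by auto
qed (use assms in auto)

text \<open>Each step of \<open>\<xi>\<close> strips the word of the codistance on the left and each
  step of \<open>\<eta>\<close> on the right. As \<open>K\<close> is odd, the word read from the
  right again begins with \<open>a\<close>, so both rays can have the same type. Pairs with
  \<open>i + j = K\<close> are opposite.\<close>

lemma zigzag_codistance:
  assumes ab: "a \<in> S" "b \<in> S" "cox_m W a b = 0" and K: "odd K" "i + j \<le> K"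
    and \<xi>: "A.zigzag a b \<xi>" and \<eta>: "B.zigzag a b \<eta>"
    and ds: "ds (\<xi> 0) (\<eta> 0) = wp (map (zig a b) [0..<K])"
  shows "ds (\<xi> i) (\<eta> j) = wp (map (zig a b) [i..<K - j])"
proof -
  have c: "\<xi> k \<in> Ca" "\<eta> k \<in> Cb" for k using \<xi> \<eta> by (auto simp: A.zigzag_def B.zigzag_def)
  let ?w = "\<lambda>i j. wp (map (zig a b) [i..<j])"
  have wc: "?w i j \<in> carrier W" for i j using set_map_zig[OF ab(1,2)] by (rule wp_closed)
  have eq: "?w 0 K = ?w 0 i \<otimes> ?w i K" using wp_map_zig_append[OF ab(1,2), of 0 i K] K by simp
  have "ds (\<xi> i) (\<eta> 0) = ?w i K"
  proof (rule descending_gallery[OF A.zigzag_gallery[OF ab(1,2) \<xi>] c(2) wc])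
    show "ds (\<xi> 0) (\<eta> 0) = ?w 0 i \<otimes> ?w i K" using ds eq by simp
    show "len (?w 0 i \<otimes> ?w i K) = length (map (zig a b) [0..<i]) + len (?w i K)"
      unfolding eq[symmetric] using len_map_zig[OF ab] K by simp
  qed simp
  moreover have "inv (?w 0 j) = ?w (K - j) K"
  proof -
    have "wp (rev (map (zig a b) [0..<j])) = inv (?w 0 j)"
      using zig_in[OF ab(1,2)] by (intro word_prod_rev) auto
    thus ?thesis using rev_map_zig[of K j a b] K by simp
  qed
  moreover have eq': "?w i K = ?w i (K - j) \<otimes> ?w (K - j) K"
    using wp_map_zig_append[OF ab(1,2), of i "K - j" K] K by simp
  moreover have "len (?w i K) = j + len (?w i (K - j))"
    using len_map_zig[OF ab, of i K] len_map_zig[OF ab, of i "K - j"] K by simp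
  ultimately show ?thesis
    using descending_gallery_right[OF B.zigzag_gallery[OF ab(1,2) \<eta>, of 0 j] c(1) wc, of i i "K - j"] by simp
qed

end

section \<open>The cup product cocycle and the loop of opposite pairs\<close>

lemma finite_if_finite_fibers:
  assumes "finite (f ` A)" "\<And>a. a \<in> A \<Longrightarrow> finite {b \<in> A. f b = f a}"
  shows "finite A"
  using assms pigeonhole_infinite[of A f] by blast

context twin_chamber_system
begin

text \<open>The fibres of \<open>g \<mapsto> (\<phi> g x, \<phi> g y)\<close> lie in cosets of the
  finite stabiliser of the base pair.\<close>

lemma finite_near_base:
  fixes G :: "('g, 'e) monoid_scheme" and \<phi> :: "'g \<Rightarrow> 'c \<Rightarrow> 'c"
  assumes act: "group_action G (Ca \<union> Cb) \<phi>"
    and base: "x \<in> Ca" "y \<in> Cb"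
    and T: "finite {g \<in> carrier G. \<phi> g x = x \<and> \<phi> g y = y}" and NA: "finite NA" and NB: "finite NB"
  shows "finite {g \<in> carrier G. \<phi> g x \<in> NA \<and> \<phi> g y \<in> NB}" (is "finite ?F")
proof (rule finite_if_finite_fibers[where f = "\<lambda>g. (\<phi> g x, \<phi> g y)"])
  have "(\<lambda>g. (\<phi> g x, \<phi> g y)) ` ?F \<subseteq> NA \<times> NB" by auto
  thus "finite ((\<lambda>g. (\<phi> g x, \<phi> g y)) ` ?F)" using NA NB by (meson finite_SigmaI finite_subset)
next
  interpret act: group_action G "Ca \<union> Cb" \<phi> by (rule act)
  interpret G: group G using act.group_hom unfolding group_hom_def by blast
  fix g assume "g \<in> ?F"
  hence g: "g \<in> carrier G" by simp
  have "{h \<in> ?F. (\<phi> h x, \<phi> h y) = (\<phi> g x, \<phi> g y)}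
    \<subseteq> (\<lambda>t. g \<otimes>\<^bsub>G\<^esub> t) ` {t \<in> carrier G. \<phi> t x = x \<and> \<phi> t y = y}"
  proof
    fix h assume "h \<in> {h \<in> ?F. (\<phi> h x, \<phi> h y) = (\<phi> g x, \<phi> g y)}"
    hence h: "h \<in> carrier G" "\<phi> h x = \<phi> g x" "\<phi> h y = \<phi> g y" by auto
    have "\<phi> (inv\<^bsub>G\<^esub> g \<otimes>\<^bsub>G\<^esub> h) z = z" if "z \<in> Ca \<union> Cb" "\<phi> h z = \<phi> g z" for z
      using act.composition_rule[OF that(1), of "inv\<^bsub>G\<^esub> g" h] act.orbit_sym_aux[OF g that(1), of "\<phi> g z"] that g h by simp
    hence "inv\<^bsub>G\<^esub> g \<otimes>\<^bsub>G\<^esub> h \<in> {t \<in> carrier G. \<phi> t x = x \<and> \<phi> t y = y}"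
      using g h base by simp
    moreover have "h = g \<otimes>\<^bsub>G\<^esub> (inv\<^bsub>G\<^esub> g \<otimes>\<^bsub>G\<^esub> h)" using g h by (simp add: G.m_assoc[symmetric])
    ultimately show "h \<in> (\<lambda>t. g \<otimes>\<^bsub>G\<^esub> t) ` {t \<in> carrier G. \<phi> t x = x \<and> \<phi> t y = y}" by blast
  qed
  thus "finite {h \<in> ?F. (\<phi> h x, \<phi> h y) = (\<phi> g x, \<phi> g y)}"
    using T by (meson finite_imageI finite_subset)
qed

lemma finite_ball:
  assumes "x \<in> Ca" "\<And>s. s \<in> S \<Longrightarrow> finite (panel W Ca da s x)"
  shows "finite {z \<in> Ca. da x z \<in> insert \<one> S}"
proof -
  have "finite S" using cox by (simp add: coxeter_system_def)
  moreover have "{z \<in> Ca. da x z \<in> insert \<one> S} \<subseteq> insert x (\<Union>s\<in>S. panel W Ca da s x)"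
    using assms(1) by (auto simp: panel_def)
  ultimately show ?thesis using assms(2) by (meson finite_UN finite_insert finite_subset)
qed

lemma not_local_cocycles_trivial:
  fixes G :: "('g, 'e) monoid_scheme" and \<phi> :: "'g \<Rightarrow> 'c \<Rightarrow> 'c"
  assumes G: "strongly_transitive G \<phi> W Ca Cb da db ds"
    and base: "x0 \<in> Ca" "y0 \<in> Cb" "ds x0 y0 = \<one>"
    and T: "finite {g \<in> carrier G. \<phi> g x0 = x0 \<and> \<phi> g y0 = y0}"
    and panels: "\<And>s x. s \<in> S \<Longrightarrow> x \<in> Ca \<Longrightarrow> finite (panel W Ca da s x) \<and> 2 < card (panel W Ca da s x)"
      "\<And>s y. s \<in> S \<Longrightarrow> y \<in> Cb \<Longrightarrow> finite (panel W Cb db s y) \<and> 2 < card (panel W Cb db s y)"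
    and st: "s \<in> S" "t \<in> S" "cox_m W s t = 0"
    and H: "\<And>n. wp (alt_word s t n) \<notin> H" "\<And>n. n > 0 \<Longrightarrow> wp (alt_word t s n) \<in> H"
    and H_bd: "\<And>w r. w \<in> carrier W \<Longrightarrow> r \<in> S \<Longrightarrow> w \<in> H \<longleftrightarrow> w \<otimes> r \<notin> H \<Longrightarrow> len w \<le> 2"
  shows "\<not> local_cocycles_trivial G"
proof
  assume bound: "local_cocycles_trivial G"
  interpret fl: twin_chamber_system W S Cb Ca db da ds by (rule flip)
  have act: "group_action G (Ca \<union> Cb) \<phi>" using G by (simp add: strongly_transitive_def)
  interpret act: group_action G "Ca \<union> Cb" \<phi> by (rule act)
  interpret G: group G using act.group_hom unfolding group_hom_def by blast
  have pres: "\<phi> g ` Ca = Ca \<and> \<phi> g ` Cb = Cb \<and>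
        (\<forall>x\<in>Ca. \<forall>y\<in>Ca. da (\<phi> g x) (\<phi> g y) = da x y) \<and>
        (\<forall>x\<in>Cb. \<forall>y\<in>Cb. db (\<phi> g x) (\<phi> g y) = db x y) \<and>
        (\<forall>x\<in>Ca \<union> Cb. \<forall>y\<in>Ca \<union> Cb. ds (\<phi> g x) (\<phi> g y) = ds x y)" if "g \<in> carrier G" for g
    using G[unfolded strongly_transitive_def, THEN conjunct2, THEN conjunct1, THEN bspec, OF that] .
  have pA: "\<phi> g x \<in> Ca" if "g \<in> carrier G" "x \<in> Ca" for g x
    using pres[OF that(1), THEN conjunct1] that(2) by blast
  have pB: "\<phi> g y \<in> Cb" if "g \<in> carrier G" "y \<in> Cb" for g y
    using pres[OF that(1), THEN conjunct2, THEN conjunct1] that(2) by blast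
  have pda: "da (\<phi> g x) (\<phi> g y) = da x y" if "g \<in> carrier G" "x \<in> Ca" "y \<in> Ca" for g x y
    using pres[OF that(1), THEN conjunct2, THEN conjunct2, THEN conjunct1] that(2,3) by blast
  have pdb: "db (\<phi> g x) (\<phi> g y) = db x y" if "g \<in> carrier G" "x \<in> Cb" "y \<in> Cb" for g x y
    using pres[OF that(1), THEN conjunct2, THEN conjunct2, THEN conjunct2, THEN conjunct1] that(2,3) by blast
  have pds: "ds (\<phi> g x) (\<phi> g y) = ds x y" if "g \<in> carrier G" "x \<in> Ca" "y \<in> Cb" for g x y
    using pres[OF that(1), THEN conjunct2, THEN conjunct2, THEN conjunct2, THEN conjunct2] that(2,3) by blast
  have rel: "\<phi> (inv\<^bsub>G\<^esub> g \<otimes>\<^bsub>G\<^esub> h) z = \<phi> (inv\<^bsub>G\<^esub> g) (\<phi> h z)" "\<phi> (inv\<^bsub>G\<^esub> g) (\<phi> g z) = z"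
    if "g \<in> carrier G" "h \<in> carrier G" "z \<in> Ca \<union> Cb" for g h z
    using act.composition_rule[OF that(3), of "inv\<^bsub>G\<^esub> g" h] act.orbit_sym_aux[OF that(1,3) refl] that by simp_all
  have rela: "da x0 (\<phi> (inv\<^bsub>G\<^esub> g \<otimes>\<^bsub>G\<^esub> h) x0) = da (\<phi> g x0) (\<phi> h x0)"
    and relb: "db y0 (\<phi> (inv\<^bsub>G\<^esub> g \<otimes>\<^bsub>G\<^esub> h) y0) = db (\<phi> g y0) (\<phi> h y0)"
    if "g \<in> carrier G" "h \<in> carrier G" for g h
    using pda[of "inv\<^bsub>G\<^esub> g" "\<phi> g x0" "\<phi> h x0"] pdb[of "inv\<^bsub>G\<^esub> g" "\<phi> g y0" "\<phi> h y0"]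
      rel[of g h x0] rel[of g h y0] pA[of _ x0] pB[of _ y0] that base by simp_all

  \<comment> \<open>The group elements that carry an opposite pair to the next one on the loop: each
    of its two chambers moves by at most one adjacency.\<close>
  define F where "F = {g \<in> carrier G. \<phi> g x0 \<in> {z \<in> Ca. da x0 z \<in> insert \<one> S} \<and>
    \<phi> g y0 \<in> {z \<in> Cb. db y0 z \<in> insert \<one> S}}"
  have "finite F"
    unfolding F_def
    by (rule finite_near_base[OF act base(1,2) T])
      (use finite_ball fl.finite_ball panels base in blast)+
  moreover have "F \<subseteq> carrier G" by (auto simp: F_def)
  ultimately obtain F' where F': "finite F'" "F' \<subseteq> carrier G"
    and F'_a: "\<And>c. local_cocycle G F' c \<Longrightarrow>
        \<exists>a. \<forall>g\<in>carrier G. \<forall>k\<in>F. c g (g \<otimes>\<^bsub>G\<^esub> k) = a (g \<otimes>\<^bsub>G\<^esub> k) - a g"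
    using bound unfolding local_cocycles_trivial_def by metis
  \<comment> \<open>A sum rather than a maximum, so that an empty \<open>F'\<close> needs no
    separate treatment.\<close>
  define L where "L = (\<Sum>f\<in>F'. len (da x0 (\<phi> f x0)) + len (db y0 (\<phi> f y0)))"
  have L: "len (da x0 (\<phi> f x0)) \<le> L" "len (db y0 (\<phi> f y0)) \<le> L" if "f \<in> F'" for f
    using member_le_sum[of f F' "\<lambda>f. len (da x0 (\<phi> f x0)) + len (db y0 (\<phi> f y0))"] that F'
    by (simp_all add: L_def)

  \<comment> \<open>\<open>K\<close> is odd for the palindrome. The chambers \<open>p\<close> and
    \<open>q\<close> lie one step along their rays, so their codistance has length
    \<open>K - 2 = 2 * L + 5\<close>, just above twice \<open>L + 2\<close>.\<close>
  define K where "K = 2 * L + 7"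
  have K: "odd K" "K \<ge> 7" by (simp_all add: K_def)
  obtain x where x: "x \<in> Ca" "ds x y0 = wp (map (zig s t) [0..<K])"
    using ex_codistance[OF base set_map_zig[OF st(1,2)]] by blast
  obtain \<xi>1 \<xi>2 where \<xi>: "A.zigzag s t \<xi>1" "A.zigzag s t \<xi>2" "\<xi>1 0 = x" "\<xi>2 0 = x"
    and \<xi>H: "\<And>k. da (\<xi>1 1) (\<xi>1 k) \<in> H \<longleftrightarrow> k \<ge> 2" "\<And>k. da (\<xi>1 1) (\<xi>2 k) \<notin> H"
    using A.branching_zigzags[OF st x(1) _ H] panels(1)[OF st(1) x(1)] by blast
  obtain \<eta>1 \<eta>2 where \<eta>: "B.zigzag s t \<eta>1" "B.zigzag s t \<eta>2" "\<eta>1 0 = y0" "\<eta>2 0 = y0"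
    and \<eta>H: "\<And>k. db (\<eta>1 1) (\<eta>1 k) \<in> H \<longleftrightarrow> k \<ge> 2" "\<And>k. db (\<eta>1 1) (\<eta>2 k) \<notin> H"
    using B.branching_zigzags[OF st base(2) _ H] panels(2)[OF st(1) base(2)] by blast
  define p q where "p = \<xi>1 1" and "q = \<eta>1 1"
  have pq: "p \<in> Ca" "q \<in> Cb" using \<xi> \<eta> by (simp_all add: p_def q_def A.zigzag_def B.zigzag_def)
  have "ds p q = wp (map (zig s t) [1..<K - 1])"
    unfolding p_def q_def by (rule zigzag_codistance[OF st K(1) _ \<xi>(1) \<eta>(1)]) (use K x \<xi> \<eta> in auto)
  hence len_pq: "len (ds p q) = 2 * L + 5"
    using len_map_zig[OF st, of 1 "K - 1"] by (simp add: K_def)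

  define X where "X z = (if da p z \<in> H then 1 else 0 :: int)" for z
  define Y where "Y z = (if db q z \<in> H then 1 else 0 :: int)" for z
  define c where "c g h = (X (\<phi> h x0) - X (\<phi> g x0)) * Y (\<phi> g y0)" for g h
  have "local_cocycle G F' c"
    unfolding local_cocycle_def
  proof (intro ballI impI, elim conjE)
    fix g h k assume g: "g \<in> carrier G" and h: "h \<in> carrier G" and k: "k \<in> carrier G"
      and gh: "inv\<^bsub>G\<^esub> g \<otimes>\<^bsub>G\<^esub> h \<in> F'" and hk: "inv\<^bsub>G\<^esub> h \<otimes>\<^bsub>G\<^esub> k \<in> F'"
    \<comment> \<open>The defect of the cocycle equation is \<open>X\<close> changing from
      \<open>h\<close> to \<open>k\<close> times \<open>Y\<close> changing from \<open>g\<close> to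
      \<open>h\<close>. If both changes occur, the pair of \<open>h\<close> is within
      \<open>L + 2\<close> of \<open>p\<close> and of \<open>q\<close>. This pair is opposite, so
      the codistance of \<open>p\<close> and \<open>q\<close> would have length at most
      \<open>2 * L + 4\<close>.\<close>
    have "X (\<phi> k x0) = X (\<phi> h x0) \<or> Y (\<phi> h y0) = Y (\<phi> g y0)"
    proof (rule ccontr)
      assume neg: "\<not> (X (\<phi> k x0) = X (\<phi> h x0) \<or> Y (\<phi> h y0) = Y (\<phi> g y0))"
      have "da p (\<phi> h x0) \<in> H \<longleftrightarrow> da p (\<phi> k x0) \<notin> H" using neg by (auto simp: X_def split: if_splits)
      hence "len (da p (\<phi> h x0)) \<le> len (da (\<phi> h x0) (\<phi> k x0)) + 2"
        by (rule A.separating_set_boundary[OF _ pq(1) pA[OF h base(1)] pA[OF k base(1)], rotated]) (rule H_bd)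
      also have "\<dots> \<le> L + 2" using L(1)[OF hk] rela[OF h k] by simp
      finally have a: "len (da p (\<phi> h x0)) \<le> L + 2" .
      have "db q (\<phi> h y0) \<in> H \<longleftrightarrow> db q (\<phi> g y0) \<notin> H" using neg by (auto simp: Y_def split: if_splits)
      hence "len (db q (\<phi> h y0)) \<le> len (db (\<phi> h y0) (\<phi> g y0)) + 2"
        by (rule B.separating_set_boundary[OF _ pq(2) pB[OF h base(2)] pB[OF g base(2)], rotated]) (rule H_bd)
      also have "len (db (\<phi> h y0) (\<phi> g y0)) = len (db (\<phi> g y0) (\<phi> h y0))"
        using B.d_sym[of "\<phi> g y0" "\<phi> h y0"] pB base g h by simp
      also have "\<dots> \<le> L" using L(2)[OF gh] relb[OF g h] by simp
      finally have b: "len (db q (\<phi> h y0)) \<le> L + 2" by simp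
      have "len (ds p q) \<le> len (ds (\<phi> h x0) q) + len (da p (\<phi> h x0))"
        using len_ds_left[of p "\<phi> h x0" q] pA pq base h by simp
      also have "len (ds (\<phi> h x0) q) \<le> len (ds (\<phi> h x0) (\<phi> h y0)) + len (db q (\<phi> h y0))"
        using len_ds_right[of "\<phi> h x0" q "\<phi> h y0"] pA pB pq base h by simp
      also have "ds (\<phi> h x0) (\<phi> h y0) = \<one>" using pds base h by simp
      finally show False using a b len_pq by simp
    qed
    moreover have "c g h + c h k - c g k = (X (\<phi> k x0) - X (\<phi> h x0)) * (Y (\<phi> h y0) - Y (\<phi> g y0))"
      by (simp add: c_def algebra_simps)
    ultimately show "c g h + c h k = c g k" by auto
  qed
  then obtain a where a: "\<And>g k. g \<in> carrier G \<Longrightarrow> k \<in> F \<Longrightarrow> c g (g \<otimes>\<^bsub>G\<^esub> k) = a (g \<otimes>\<^bsub>G\<^esub> k) - a g"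
    using F'_a by blast

  \<comment> \<open>Several group elements carry the base pair to a given opposite pair. Fixing one
    of them makes \<open>a\<close> a function of opposite pairs, so that the paths below fit
    together at their ends.\<close>
  define \<gamma> where "\<gamma> x y = (SOME g. g \<in> carrier G \<and> \<phi> g x0 = x \<and> \<phi> g y0 = y)" for x y
  have \<gamma>: "\<gamma> x y \<in> carrier G" "\<phi> (\<gamma> x y) x0 = x" "\<phi> (\<gamma> x y) y0 = y"
    if "x \<in> Ca" "y \<in> Cb" "ds x y = \<one>" for x y
    using someI_ex[of "\<lambda>g. g \<in> carrier G \<and> \<phi> g x0 = x \<and> \<phi> g y0 = y"]
      opposite_pairs_transitive[OF G base that] unfolding \<gamma>_def by metis+
  have step: "(X x' - X x) * Y y = a (\<gamma> x' y') - a (\<gamma> x y)"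
    if xy: "x \<in> Ca" "y \<in> Cb" "ds x y = \<one>" and xy': "x' \<in> Ca" "y' \<in> Cb" "ds x' y' = \<one>"
      and adj: "da x x' \<in> S" "db y y' \<in> S" for x y x' y'
  proof -
    note g = \<gamma>[OF xy] and h = \<gamma>[OF xy']
    have m: "inv\<^bsub>G\<^esub> (\<gamma> x y) \<otimes>\<^bsub>G\<^esub> \<gamma> x' y' \<in> carrier G" using g h by simp
    hence "inv\<^bsub>G\<^esub> (\<gamma> x y) \<otimes>\<^bsub>G\<^esub> \<gamma> x' y' \<in> F"
      using rela[OF g(1) h(1)] relb[OF g(1) h(1)] pA[OF m base(1)] pB[OF m base(2)] g h adj
      by (simp add: F_def)
    moreover have "\<gamma> x y \<otimes>\<^bsub>G\<^esub> (inv\<^bsub>G\<^esub> (\<gamma> x y) \<otimes>\<^bsub>G\<^esub> \<gamma> x' y') = \<gamma> x' y'"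
      using g h by (simp add: G.m_assoc[symmetric])
    ultimately show ?thesis using a[OF g(1)] g h by (metis c_def)
  qed

  \<comment> \<open>The pair \<open>(\<xi> k, \<eta> (K - k))\<close> moves through opposite pairs
    from \<open>(x, \<eta> K)\<close> to \<open>(\<xi> K, y0)\<close>. The first end depends only on
    \<open>\<eta>\<close>, the second only on \<open>\<xi>\<close>.\<close>
  have telescope: "(\<Sum>k<K. (X (\<xi> (Suc k)) - X (\<xi> k)) * Y (\<eta> (K - k)))
      = a (\<gamma> (\<xi> K) y0) - a (\<gamma> x (\<eta> K))"
    if \<xi>z: "A.zigzag s t \<xi>" "\<xi> 0 = x" and \<eta>z: "B.zigzag s t \<eta>" "\<eta> 0 = y0" for \<xi> \<eta>
  proof -
    have c: "\<xi> k \<in> Ca" "\<eta> k \<in> Cb" for k using \<xi>z \<eta>z by (auto simp: A.zigzag_def B.zigzag_def)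
    have opp: "ds (\<xi> k) (\<eta> (K - k)) = \<one>" if "k \<le> K" for k
      using zigzag_codistance[OF st K(1) _ \<xi>z(1) \<eta>z(1), of k "K - k"] that x \<xi>z \<eta>z by simp
    have "(X (\<xi> (Suc k)) - X (\<xi> k)) * Y (\<eta> (K - k))
      = a (\<gamma> (\<xi> (Suc k)) (\<eta> (K - Suc k))) - a (\<gamma> (\<xi> k) (\<eta> (K - k)))" if "k < K" for k
    proof (rule step)
      show "da (\<xi> k) (\<xi> (Suc k)) \<in> S" using \<xi>z zig_in st by (simp add: A.zigzag_def)
      have "db (\<eta> (K - Suc k)) (\<eta> (Suc (K - Suc k))) \<in> S" using \<eta>z zig_in st by (simp add: B.zigzag_def)
      hence "db (\<eta> (K - Suc k)) (\<eta> (K - k)) \<in> S" using that by (simp add: Suc_diff_Suc)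
      thus "db (\<eta> (K - k)) (\<eta> (K - Suc k)) \<in> S" using B.adj_sym c by metis
    qed (use c opp that in simp_all)
    hence "(\<Sum>k<K. (X (\<xi> (Suc k)) - X (\<xi> k)) * Y (\<eta> (K - k)))
      = (\<Sum>k<K. a (\<gamma> (\<xi> (Suc k)) (\<eta> (K - Suc k))) - a (\<gamma> (\<xi> k) (\<eta> (K - k))))"
      by simp
    also have "\<dots> = a (\<gamma> (\<xi> K) (\<eta> (K - K))) - a (\<gamma> (\<xi> 0) (\<eta> (K - 0)))"
      by (rule sum_lessThan_telescope)
    finally show ?thesis using \<xi>z \<eta>z by simp
  qed

  have X1: "X (\<xi>1 k) = (if k \<ge> 2 then 1 else 0)" and X2: "X (\<xi>2 k) = 0" for k
    using \<xi>H by (simp_all add: X_def p_def)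
  have Y1: "Y (\<eta>1 k) = (if k \<ge> 2 then 1 else 0)" and Y2: "Y (\<eta>2 k) = 0" for k
    using \<eta>H by (simp_all add: Y_def q_def)
  \<comment> \<open>Along \<open>\<xi>1\<close> the function \<open>X\<close> jumps only between the
    indices one and two. At that moment \<open>Y\<close> is taken at index \<open>K - 1\<close>, far
    beyond the start of \<open>\<eta>1\<close>, and equals one.\<close>
  have "(\<Sum>k<K. (X (\<xi>1 (Suc k)) - X (\<xi>1 k)) * Y (\<eta>1 (K - k))) = (\<Sum>k<K. if k = 1 then 1 else 0)"
    by (rule sum.cong) (use K in \<open>auto simp: X1 Y1\<close>)
  also have "\<dots> = 1" using K by (simp add: sum.delta)
  \<comment> \<open>In the alternating sum of the four telescopes the right-hand sides cancel. On
    the left, one sum is one and the others vanish, since \<open>X\<close> is zero on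
    \<open>\<xi>2\<close> and \<open>Y\<close> is zero on \<open>\<eta>2\<close>.\<close>
  finally show False
    using telescope[OF \<xi>(1,3) \<eta>(1,3)] telescope[OF \<xi>(1,3) \<eta>(2,4)]
      telescope[OF \<xi>(2,4) \<eta>(1,3)] telescope[OF \<xi>(2,4) \<eta>(2,4)]
    by (simp add: X2 Y2)
qed

end

theorem mainTheorem18:
  fixes W :: "('w, 'b) monoid_scheme" and S :: "'w set"
    and Cp Cm :: "'c set" and dp dm ds :: "'c \<Rightarrow> 'c \<Rightarrow> 'w"
    and q :: "'w \<Rightarrow> nat"
    and G :: "('g, 'e) monoid_scheme" and \<phi> :: "'g \<Rightarrow> 'c \<Rightarrow> 'c"
    and Cplus Cminus :: 'c
  assumes cox: "coxeter_system W S"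
    and twin: "twin_building W S Cp Cm dp dm ds"
    and q_ge: "\<forall>s\<in>S. q s \<ge> 2"
    and panels_p: "\<forall>s\<in>S. \<forall>x\<in>Cp. finite (panel W Cp dp s x) \<and> card (panel W Cp dp s x) = q s + 1"
    and panels_m: "\<forall>s\<in>S. \<forall>x\<in>Cm. finite (panel W Cm dm s x) \<and> card (panel W Cm dm s x) = q s + 1"
    and grp: "group G"
    and strans: "strongly_transitive G \<phi> W Cp Cm dp dm ds"
    and Cplus: "Cplus \<in> Cp" and Cminus: "Cminus \<in> Cm"
    and opp: "ds Cplus Cminus = \<one>\<^bsub>W\<^esub>"
    and T_fin: "finite {g \<in> carrier G. \<phi> g Cplus = Cplus \<and> \<phi> g Cminus = Cminus}"
    and rank3: "card S = 3"
    and inf_m: "\<exists>s\<in>S. \<exists>t\<in>S. cox_m W s t = 0"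
  shows "\<not> (\<exists>(P0 :: 'p0::ab_group_add set) a0 (P1 :: 'p1::ab_group_add set) a1
              (P2 :: 'p2::ab_group_add set) a2 e d1 d2.
            FP2_resolution G P0 a0 P1 a1 P2 a2 e d1 d2)
         \<and> \<not> finitely_presented G"
proof -
  obtain s t where st: "s \<in> S" "t \<in> S" "cox_m W s t = 0" using inf_m by blast
  interpret twin_chamber_system W S Cp Cm dp dm ds
    by unfold_locales (fact cox, fact twin)
  have "s \<noteq> t" using st by (auto simp: cox_m_def ord_id)
  hence "card (S - {s, t}) = 1" using rank3 st by (simp add: card_Diff_subset)
  then obtain u where u: "S - {s, t} = {u}" by (auto simp: card_1_singleton_iff)
  hence "S = {s, t, u}" "s \<noteq> u" "t \<noteq> u" using st by auto
  then obtain H where H: "\<And>n. wp (alt_word s t n) \<notin> H" "\<And>n. n > 0 \<Longrightarrow> wp (alt_word t s n) \<in> H"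
    "\<And>w r. w \<in> carrier W \<Longrightarrow> r \<in> S \<Longrightarrow> w \<in> H \<longleftrightarrow> w \<otimes>\<^bsub>W\<^esub> r \<notin> H \<Longrightarrow> len w \<le> 2"
    using separating_set[of s t u] \<open>s \<noteq> t\<close> st by metis
  have thick: "finite (panel W Cp dp s x) \<and> 2 < card (panel W Cp dp s x)" if "s \<in> S" "x \<in> Cp" for s x
    using that panels_p q_ge by fastforce
  have thick': "finite (panel W Cm dm s x) \<and> 2 < card (panel W Cm dm s x)" if "s \<in> S" "x \<in> Cm" for s x
    using that panels_m q_ge by fastforce
  have "\<not> local_cocycles_trivial G"
    by (rule not_local_cocycles_trivial[OF strans Cplus Cminus opp T_fin thick thick' st H])
  thus ?thesis using group.FP2_imp_local_cocycles_trivial[OF grp] group.finitely_presented_imp_local_cocycles_trivial[OF grp] by blast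
qed

end
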